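(* Let $f$, $q$, $\alpha$, $V_1$ and the constants $c_\phi,c_z,\sigma,\lambda>0$ satisfy the standing hypotheses (i)--(iv) listed in the context, let $c>0$, and consider, for an arbitrary admissible control $u$, the dynamics in the coordinates $(x_1,z,e)$, $e=x_2-\alpha(x_1,z)$, $$\dot x_1=\alpha(x_1,z)+e,\qquad \dot z=q(x_1,z),\qquad \dot e=u-\dot\alpha,$$ from a given initial state. Define $V:=V_1(x_1,z)+\frac12\|e\|^2$ and $$\ell_\alpha(x_1,z,e,u):=\sigma\|\nabla f(x_1)\|^2+\frac c2\|e\|^2+\frac1{2c}\|u-\dot\alpha+\lambda\nabla f(x_1)\|^2 ,$$ and for each $T>0$ the functional $$J_T^\alpha(u):=V(x_1(T),z(T),e(T))+\int_0^T\ell_\alpha(x_1,z,e,u)\,dt .$$ Then, for every $T>0$, the control $$u^\star:=\dot\alpha-ce-\lambda\nabla f(x_1)$$ is the unique minimizer of $J_T^\alpha$ over all admissible controls on $[0,T]$.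
   Context: $\|\cdot\|$ is the Euclidean norm. Standing hypotheses: (i) $f:\mathbb{R}^n\to\mathbb{R}$ is $C^2$, convex, $L$-smooth ($\|\nabla f(x)-\nabla f(y)\|\le L\|x-y\|$), and bounded below; $f^\star:=\inf f$, $\phi(x_1):=f(x_1)-f^\star$. (ii) $q:\mathbb{R}^n\times\mathbb{R}^m\to\mathbb{R}^m$ is locally Lipschitz; the underlying system is $\dot x_1=x_2$, $\dot x_2=u$, $\dot z=q(x_1,z)$ with $x_1,x_2,u\in\mathbb{R}^n$, $z\in\mathbb{R}^m$ (for $m=0$ there is no $z$). (iii) $V_1:\mathbb{R}^n\times\mathbb{R}^m\to\mathbb{R}$ is $C^1$, $V_1(x_1,z)\ge c_\phi\phi(x_1)+c_z\|z\|^2$ for all $(x_1,z)$, and along $\dot x_1=\alpha+e$, $\dot z=q$ one has $\dot V_1=-\sigma\|\nabla f(x_1)\|^2+\lambda\nabla f(x_1)^\top e$; i.e. for all $(x_1,z,e)$, $\nabla_{x_1}V_1^\top(\alpha+e)+\nabla_zV_1^\top q=-\sigma\|\nabla f(x_1)\|^2+\lambda\nabla f(x_1)^\top e$. (iv) $\alpha:\mathbb{R}^n\times\mathbb{R}^m\to\mathbb{R}^n$ is $C^1$, and boundedness of $(\nabla f(x_1),z)$ implies boundedness of $\alpha(x_1,z)$: for every $R>0$, $\alpha$ is bounded on $\{\|\nabla f(x_1)\|\le R,\ \|z\|\le R\}$. $\dot\alpha=\frac{\partial\alpha}{\partial x_1}x_2+\frac{\partial\alpha}{\partial z}q(x_1,z)$,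 with $x_2=\alpha+e$, is the total derivative of $\alpha$ along the system. An admissible control on $[0,T]$ is an integrable function $u:[0,T]\to\mathbb{R}^n$ for which the dynamics from the given initial state have an (absolutely continuous) solution on $[0,T]$; controls equal almost everywhere are identified. $u^\star$ is understood as the control signal generated by the stated feedback along its own closed-loop trajectory. The integral in $J_T^\alpha$ may be $+\infty$. *)

theory Defs
  imports "HOL-Analysis.Analysis"
begin

(* The space R^m of the variable z is rendered as an arbitrary type of sort
   {real_inner, heine_borel, banach}.  A real inner product space whose bounded sequences have
   convergent subsequences is a finite-dimensional Euclidean space, so these types are, up to
   isometry, exactly the R^m; banach is implied by the other two and is listed only because sort
   inference does not derive it.  Unlike class euclidean_space (hence unlike real ^ 'm), this
   sort admits dimension m = 0; the type below is an inhabitant of that dimension.  All types of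
   class euclidean_space have this sort. *)

datatype origin = Origin

instantiation origin :: real_inner
begin

definition zero_origin :: origin where "zero_origin = Origin"
definition plus_origin :: "origin \<Rightarrow> origin \<Rightarrow> origin" where "plus_origin x y = Origin"
definition minus_origin :: "origin \<Rightarrow> origin \<Rightarrow> origin" where "minus_origin x y = Origin"
definition uminus_origin :: "origin \<Rightarrow> origin" where "uminus_origin x = Origin"
definition scaleR_origin :: "real \<Rightarrow> origin \<Rightarrow> origin" where "scaleR_origin r x = Origin"
definition inner_origin :: "origin \<Rightarrow> origin \<Rightarrow> real" where "inner_origin x y = 0"
definition norm_origin :: "origin \<Rightarrow> real" where "norm_origin x = 0"
definition dist_origin :: "origin \<Rightarrow> origin \<Rightarrow> real" where "dist_origin x y = 0"
definition sgn_origin :: "origin \<Rightarrow> origin" where "sgn_origin x = Origin"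
definition uniformity_origin :: "(origin \<times> origin) filter" where
  "uniformity_origin = (INF e\<in>{0<..}. principal {(x, y). dist x y < e})"
definition open_origin :: "origin set \<Rightarrow> bool" where
  "open_origin U \<longleftrightarrow> (\<forall>x\<in>U. eventually (\<lambda>(x', y). x' = x \<longrightarrow> y \<in> U) uniformity)"

instance
proof -
  have eq: "x = y" for x y :: origin by (cases x; cases y) simp
  show "OFCLASS(origin, real_inner_class)"
    by standard
      (rule eq uniformity_origin_def open_origin_def |
       simp add: inner_origin_def norm_origin_def dist_origin_def eq[of _ 0])+
qed

end

instance origin :: heine_borel
proof
  fix s :: "nat \<Rightarrow> origin"
  have "s \<circ> id = (\<lambda>_. Origin)"
    by (rule ext) (metis origin.exhaust)
  then have "((s \<circ> id) \<longlongrightarrow> Origin) sequentially" by simp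
  then show "\<exists>l r. strict_mono (r :: nat \<Rightarrow> nat) \<and> ((s \<circ> r) \<longlongrightarrow> l) sequentially"
    using strict_mono_id by blast
qed

instance origin :: banach ..


definition C1 :: "('a::real_normed_vector \<Rightarrow> 'b::real_normed_vector) \<Rightarrow> bool" where
  "C1 g \<longleftrightarrow> (\<exists>D :: 'a \<Rightarrow> ('a \<Rightarrow>\<^sub>L 'b).
     (\<forall>x. (g has_derivative blinfun_apply (D x)) (at x)) \<and> continuous_on UNIV D)"

definition C2 :: "('a::real_normed_vector \<Rightarrow> 'b::real_normed_vector) \<Rightarrow> bool" where
  "C2 g \<longleftrightarrow> (\<exists>D :: 'a \<Rightarrow> ('a \<Rightarrow>\<^sub>L 'b).
     (\<forall>x. (g has_derivative blinfun_apply (D x)) (at x)) \<and> C1 D)"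

definition locally_lipschitz :: "('a::metric_space \<Rightarrow> 'b::metric_space) \<Rightarrow> bool" where
  "locally_lipschitz g \<longleftrightarrow> (\<forall>p. \<exists>r>0. \<exists>K. K-lipschitz_on (ball p r) g)"

definition grad :: "('a::real_inner \<Rightarrow> real) \<Rightarrow> 'a \<Rightarrow> 'a" where
  "grad g x = (THE D. GDERIV g x :> D)"

(* The family d consists of finitely many compact intervals with disjoint interiors. *)
definition abs_cont_on :: "real \<Rightarrow> real \<Rightarrow> (real \<Rightarrow> 'b::real_normed_vector) \<Rightarrow> bool" where
  "abs_cont_on a b g \<longleftrightarrow> (\<forall>\<epsilon>>0. \<exists>\<delta>>0. \<forall>d. d division_of \<Union>d \<and> \<Union>d \<subseteq> {a..b} \<and>
     (\<Sum>k\<in>d. Sup k - Inf k) < \<delta> \<longrightarrow> (\<Sum>k\<in>d. norm (g (Sup k) - g (Inf k))) < \<epsilon>)"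

(* The total derivative of alpha along x1' = alpha(x1,z) + e, z' = q(x1,z). *)
definition alpha_dot ::
  "('a::real_normed_vector \<Rightarrow> 'z::real_normed_vector \<Rightarrow> 'z) \<Rightarrow> ('a \<Rightarrow> 'z \<Rightarrow> 'a) \<Rightarrow> 'a \<Rightarrow> 'z \<Rightarrow> 'a \<Rightarrow> 'a"
  where
  "alpha_dot q \<alpha> x z e =
     frechet_derivative (\<lambda>x'. \<alpha> x' z) (at x) (\<alpha> x z + e) +
     frechet_derivative (\<lambda>z'. \<alpha> x z') (at z) (q x z)"

(* Absolutely continuous (Caratheodory) solutions on [0,T].  The underlying second-order state
   is recovered as x2 = alpha(x1,z) + e. *)
definition solution ::
  "('a::real_normed_vector \<Rightarrow> 'z::real_normed_vector \<Rightarrow> 'z) \<Rightarrow> ('a \<Rightarrow> 'z \<Rightarrow> 'a) \<Rightarrow> real \<Rightarrow>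
   'a \<times> 'z \<times> 'a \<Rightarrow> (real \<Rightarrow> 'a) \<Rightarrow> (real \<Rightarrow> 'a) \<Rightarrow> (real \<Rightarrow> 'z) \<Rightarrow> (real \<Rightarrow> 'a) \<Rightarrow> bool"
  where
  "solution q \<alpha> T s0 u x z e \<longleftrightarrow>
     abs_cont_on 0 T x \<and> abs_cont_on 0 T z \<and> abs_cont_on 0 T e \<and>
     (x 0, z 0, e 0) = s0 \<and>
     (AE t in lebesgue_on {0..T}.
        (x has_vector_derivative \<alpha> (x t) (z t) + e t) (at t within {0..T}) \<and>
        (z has_vector_derivative q (x t) (z t)) (at t within {0..T}) \<and>
        (e has_vector_derivative u t - alpha_dot q \<alpha> (x t) (z t) (e t)) (at t within {0..T}))"

definition admissible ::
  "('a::euclidean_space \<Rightarrow> 'z::real_normed_vector \<Rightarrow> 'z) \<Rightarrow> ('a \<Rightarrow> 'z \<Rightarrow> 'a) \<Rightarrow> real \<Rightarrow>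
   'a \<times> 'z \<times> 'a \<Rightarrow> (real \<Rightarrow> 'a) \<Rightarrow> bool"
  where
  "admissible q \<alpha> T s0 u \<longleftrightarrow>
     u absolutely_integrable_on {0..T} \<and> (\<exists>x z e. solution q \<alpha> T s0 u x z e)"

definition running_cost ::
  "('a::real_inner \<Rightarrow> real) \<Rightarrow> ('a \<Rightarrow> 'z::real_normed_vector \<Rightarrow> 'z) \<Rightarrow> ('a \<Rightarrow> 'z \<Rightarrow> 'a) \<Rightarrow>
   real \<Rightarrow> real \<Rightarrow> real \<Rightarrow> 'a \<Rightarrow> 'z \<Rightarrow> 'a \<Rightarrow> 'a \<Rightarrow> real"
  where
  "running_cost f q \<alpha> \<sigma> lam c x z e u =
     \<sigma> * (norm (grad f x))\<^sup>2 + c / 2 * (norm e)\<^sup>2 +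
     1 / (2 * c) * (norm (u - alpha_dot q \<alpha> x z e + lam *\<^sub>R grad f x))\<^sup>2"

(* For admissible u, locally Lipschitz q and C^1 alpha, the trajectory on [0,T] is unique, so
   the choice operator merely names it.  The integrand is nonnegative for sigma, c > 0. *)
definition cost_functional ::
  "('a::real_inner \<Rightarrow> real) \<Rightarrow> ('a \<Rightarrow> 'z::real_normed_vector \<Rightarrow> 'z) \<Rightarrow> ('a \<Rightarrow> 'z \<Rightarrow> 'a) \<Rightarrow>
   ('a \<Rightarrow> 'z \<Rightarrow> real) \<Rightarrow> real \<Rightarrow> real \<Rightarrow> real \<Rightarrow> real \<Rightarrow> 'a \<times> 'z \<times> 'a \<Rightarrow> (real \<Rightarrow> 'a) \<Rightarrow> ereal"
  where
  "cost_functional f q \<alpha> V\<^sub>1 \<sigma> lam c T s0 u =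
     (let (x, z, e) = (SOME (x, z, e). solution q \<alpha> T s0 u x z e) in
       ereal (V\<^sub>1 (x T) (z T) + 1 / 2 * (norm (e T))\<^sup>2) +
       enn2ereal (\<integral>\<^sup>+ t \<in> {0..T}. ennreal (running_cost f q \<alpha> \<sigma> lam c (x t) (z t) (e t) (u t))
         \<partial>lebesgue))"

(* u is the signal produced by the feedback along its own closed-loop trajectory. *)
definition feedback_control ::
  "('a::real_inner \<Rightarrow> real) \<Rightarrow> ('a \<Rightarrow> 'z::real_normed_vector \<Rightarrow> 'z) \<Rightarrow> ('a \<Rightarrow> 'z \<Rightarrow> 'a) \<Rightarrow>
   real \<Rightarrow> real \<Rightarrow> real \<Rightarrow> 'a \<times> 'z \<times> 'a \<Rightarrow> (real \<Rightarrow> 'a) \<Rightarrow> bool"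
  where
  "feedback_control f q \<alpha> lam c T s0 u \<longleftrightarrow>
     (\<exists>x z e. solution q \<alpha> T s0 u x z e \<and>
        (\<forall>t\<in>{0..T}. u t =
           alpha_dot q \<alpha> (x t) (z t) (e t) - c *\<^sub>R e t - lam *\<^sub>R grad f (x t)))"

end

theory Submission
  imports Defs
begin

text \<open>
  The whole argument is one completion of squares. Write
  \<open>V = V\<^sub>1 + \<parallel>e\<parallel>\<^sup>2/2\<close>. Along a trajectory driven by \<open>u\<close>, the decay hypothesis on \<open>V\<^sub>1\<close> gives
  \<open>V' = -\<sigma> \<parallel>\<nabla>f\<parallel>\<^sup>2 + e \<bullet> w\<close> with \<open>w = u - \<alpha>' + \<lambda> \<nabla>f\<close>, where \<open>\<alpha>'\<close> is the total derivative
  of \<open>\<alpha>\<close>, and therefore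
  \<open>l + V' = (\<parallel>w\<parallel>\<^sup>2 + 2c e \<bullet> w + c\<^sup>2 \<parallel>e\<parallel>\<^sup>2)/(2c) = \<parallel>u - k\<parallel>\<^sup>2/(2c)\<close>, where \<open>k\<close> is the value of the
  feedback law (lemma \<open>completion_of_squares\<close>).
  Integrating, the cost of \<open>u\<close> is \<open>V\<close> at the initial state plus the integral of
  \<open>\<parallel>u - k\<parallel>\<^sup>2/(2c)\<close>. So the initial value of \<open>V\<close> bounds every cost from below, and it is attained exactly
  by the controls that follow the feedback law almost everywhere.

  Four analytic facts turn this into a proof.

  First, integrating \<open>V'\<close> needs the fundamental theorem of calculus for absolutely
  continuous functions (\<open>abs_cont_on_has_integral\<close>). Together with the chain rule for \<open>C\<^sup>1\<close>
  functions it gives \<open>energy_balance\<close>. The gradients in the hypothesis on \<open>V\<^sub>1\<close> represent the partial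
  derivatives by the Riesz theorem (\<open>bounded_functional_representation\<close>).

  Second, a control must determine its trajectory. The field \<open>\<alpha>'\<close> is merely
  continuous, so the error coordinate \<open>e\<close> is not governed by a Lipschitz equation; but in the original
  velocity \<open>x\<^sub>2 = \<alpha> + e\<close> the system reads \<open>x\<^sub>1' = x\<^sub>2\<close>, \<open>x\<^sub>2' = u\<close>, \<open>z' = q\<close>, and Gronwall's
  inequality applies (\<open>open_loop_unique\<close>).

  Third, the closed loop must have a solution on all of \<open>[0,T]\<close>. Its field
  \<open>(\<alpha> + e, q, -c e - \<lambda> \<nabla>f)\<close> no longer contains \<open>\<alpha>'\<close> and is Lipschitz on bounded sets, and \<open>V\<close>
  decreases along it. Sublevel sets of \<open>V\<close> bound \<open>z\<close>, \<open>e\<close> and \<open>f\<close>, hence also \<open>\<nabla>f\<close>, because a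
  function that is bounded below and has a Lipschitz gradient satisfies
  \<open>\<parallel>\<nabla>f\<parallel>\<^sup>2 \<le> 4L (f - inf f)\<close>; thus they bound \<open>\<alpha>\<close> and the speed of \<open>x\<^sub>1\<close>, and no blow-up can occur
  (\<open>closed_loop_exists\<close>).

  Fourth, an optimal control follows the feedback law along its own
  trajectory, which a priori is another one than that of \<open>u\<^sup>\<star>\<close>. Both trajectories solve the closed loop
  equation from the same initial state, so they agree (\<open>closed_loop_unique\<close>), and so do the controls.
\<close>

section \<open>Absolute continuity and the fundamental theorem of calculus\<close>

lemma AE_lebesgue_on_iff_negligible:
  assumes "S \<in> sets lebesgue"
  shows "(AE t in lebesgue_on S. P t) \<longleftrightarrow> negligible {t \<in> S. \<not> P t}"
  (is "_ \<longleftrightarrow> negligible ?N")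
proof -
  have "(AE t in lebesgue_on S. P t) \<longleftrightarrow> (AE t in lebesgue. t \<in> S \<longrightarrow> P t)"
    using assms by (simp add: AE_restrict_space_iff)
  also have "\<dots> \<longleftrightarrow> (\<exists>N. negligible N \<and> ?N \<subseteq> N)"
    by (auto simp: eventually_ae_filter_negligible)
  also have "\<dots> \<longleftrightarrow> negligible ?N"
    using negligible_subset by blast
  finally show ?thesis .
qed

lemma division_of_interval_ends:
  fixes k :: "real set"
  assumes "d division_of S" "S \<subseteq> {a..b}" "k \<in> d"
  shows "Inf k \<in> {a..b}" "Sup k \<in> {a..b}" "Inf k \<le> Sup k" "k = {Inf k..Sup k}"
proof -
  obtain u v where k: "k = cbox u v" "k \<noteq> {}" "k \<subseteq> S"
    using division_ofD[OF assms(1)] assms(3) by metis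
  then have "u \<le> v" by auto
  moreover have "{u..v} \<subseteq> {a..b}" using k assms(2) by (metis subset_trans box_real(2))
  ultimately show "Inf k \<in> {a..b}" "Sup k \<in> {a..b}" "Inf k \<le> Sup k" "k = {Inf k..Sup k}"
    using k by auto
qed

text \<open>A function whose increments are controlled by those of \<open>g\<close> inherits the modulus of
  absolute continuity of \<open>g\<close>, up to the factor \<open>K\<close>. Lipschitz functions are the case \<open>g t = t\<close>.\<close>
lemma abs_cont_on_dominated:
  assumes g: "abs_cont_on a b g" and "K > 0"
    and le: "\<And>s t. s \<in> {a..b} \<Longrightarrow> t \<in> {a..b} \<Longrightarrow> norm (h t - h s) \<le> K * norm (g t - g s)"
  shows "abs_cont_on a b h"
  unfolding abs_cont_on_def
proof (intro allI impI)
  fix \<epsilon> :: real assume "\<epsilon> > 0"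
  with \<open>K > 0\<close> have "\<epsilon> / K > 0" by simp
  then obtain \<delta> where "\<delta> > 0" and \<delta>: "\<And>d. d division_of \<Union>d \<Longrightarrow> \<Union>d \<subseteq> {a..b} \<Longrightarrow>
     (\<Sum>k\<in>d. Sup k - Inf k) < \<delta> \<Longrightarrow> (\<Sum>k\<in>d. norm (g (Sup k) - g (Inf k))) < \<epsilon> / K"
    using g unfolding abs_cont_on_def by meson
  have "(\<Sum>k\<in>d. norm (h (Sup k) - h (Inf k))) < \<epsilon>"
    if d: "d division_of \<Union>d" "\<Union>d \<subseteq> {a..b}" "(\<Sum>k\<in>d. Sup k - Inf k) < \<delta>" for d
  proof -
    have "(\<Sum>k\<in>d. norm (h (Sup k) - h (Inf k))) \<le> (\<Sum>k\<in>d. K * norm (g (Sup k) - g (Inf k)))"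
      using division_of_interval_ends[OF d(1,2)] le by (intro sum_mono) auto
    also have "\<dots> = K * (\<Sum>k\<in>d. norm (g (Sup k) - g (Inf k)))"
      by (simp add: sum_distrib_left)
    also have "\<dots> < \<epsilon>"
      using \<delta>[OF d] \<open>K > 0\<close> by (simp add: field_simps)
    finally show ?thesis .
  qed
  with \<open>\<delta> > 0\<close> show "\<exists>\<delta>>0. \<forall>d. d division_of \<Union>d \<and> \<Union>d \<subseteq> {a..b} \<and>
     (\<Sum>k\<in>d. Sup k - Inf k) < \<delta> \<longrightarrow> (\<Sum>k\<in>d. norm (h (Sup k) - h (Inf k))) < \<epsilon>"
    by blast
qed

lemma abs_cont_on_ident: "abs_cont_on a b (\<lambda>t. t)"
proof -
  have "(\<Sum>k\<in>d. norm (Sup k - Inf k)) = (\<Sum>k\<in>d. Sup k - Inf k)"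
    if "d division_of \<Union>d" "\<Union>d \<subseteq> {a..b}" for d :: "real set set"
    using division_of_interval_ends[OF that] by (intro sum.cong) auto
  then show ?thesis
    unfolding abs_cont_on_def by metis
qed

lemma lipschitz_imp_abs_cont_on:
  fixes g :: "real \<Rightarrow> 'b::real_normed_vector"
  assumes "K-lipschitz_on {a..b} g"
  shows "abs_cont_on a b g"
proof (rule abs_cont_on_dominated[OF abs_cont_on_ident, of "K + 1"])
  show "K + 1 > 0" using lipschitz_on_nonneg[OF assms] by simp
  fix s t assume "s \<in> {a..b}" "t \<in> {a..b}"
  then have "norm (g t - g s) \<le> K * norm (t - s)"
    using lipschitz_onD[OF assms] by (simp add: dist_norm)
  then show "norm (g t - g s) \<le> (K + 1) * norm (t - s)"
    by (simp add: algebra_simps)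
qed

lemma abs_cont_on_compose_lipschitz:
  fixes W :: "'b::real_normed_vector \<Rightarrow> 'c::real_normed_vector"
  assumes "abs_cont_on a b y" "K-lipschitz_on S W" "y ` {a..b} \<subseteq> S"
  shows "abs_cont_on a b (\<lambda>t. W (y t))"
proof (rule abs_cont_on_dominated[OF assms(1), of "K + 1"])
  show "K + 1 > 0" using lipschitz_on_nonneg[OF assms(2)] by simp
  fix s t assume "s \<in> {a..b}" "t \<in> {a..b}"
  then have "y s \<in> S" "y t \<in> S" using assms(3) by blast+
  then have "norm (W (y t) - W (y s)) \<le> K * norm (y t - y s)"
    using lipschitz_onD[OF assms(2), of "y t" "y s"] by (simp add: dist_norm)
  then show "norm (W (y t) - W (y s)) \<le> (K + 1) * norm (y t - y s)"
    using norm_ge_zero[of "y t - y s"] unfolding distrib_right by linarith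
qed

lemma abs_cont_on_fst:
  assumes "abs_cont_on a b y"
  shows "abs_cont_on a b (\<lambda>t. fst (y t))"
proof (rule abs_cont_on_dominated[OF assms zero_less_one])
  fix s t show "norm (fst (y t) - fst (y s)) \<le> 1 * norm (y t - y s)"
    using norm_fst_le[of "fst (y t - y s)" "snd (y t - y s)"] by (simp del: fst_diff snd_diff flip: fst_diff)
qed

lemma abs_cont_on_snd:
  assumes "abs_cont_on a b y"
  shows "abs_cont_on a b (\<lambda>t. snd (y t))"
proof (rule abs_cont_on_dominated[OF assms zero_less_one])
  fix s t show "norm (snd (y t) - snd (y s)) \<le> 1 * norm (y t - y s)"
    using norm_snd_le[of "snd (y t - y s)" "fst (y t - y s)"] by (simp del: fst_diff snd_diff flip: snd_diff)
qed

lemma abs_cont_on_Pair: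
  assumes g: "abs_cont_on a b g" and h: "abs_cont_on a b h"
  shows "abs_cont_on a b (\<lambda>t. (g t, h t))"
  unfolding abs_cont_on_def
proof (intro allI impI)
  fix \<epsilon> :: real assume "\<epsilon> > 0"
  then have "\<epsilon> / 2 > 0" by simp
  obtain \<delta>1 where "\<delta>1 > 0" and \<delta>1: "\<And>d. d division_of \<Union>d \<Longrightarrow> \<Union>d \<subseteq> {a..b} \<Longrightarrow>
     (\<Sum>k\<in>d. Sup k - Inf k) < \<delta>1 \<Longrightarrow> (\<Sum>k\<in>d. norm (g (Sup k) - g (Inf k))) < \<epsilon> / 2"
    using g \<open>\<epsilon> / 2 > 0\<close> unfolding abs_cont_on_def by meson
  obtain \<delta>2 where "\<delta>2 > 0" and \<delta>2: "\<And>d. d division_of \<Union>d \<Longrightarrow> \<Union>d \<subseteq> {a..b} \<Longrightarrow>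
     (\<Sum>k\<in>d. Sup k - Inf k) < \<delta>2 \<Longrightarrow> (\<Sum>k\<in>d. norm (h (Sup k) - h (Inf k))) < \<epsilon> / 2"
    using h \<open>\<epsilon> / 2 > 0\<close> unfolding abs_cont_on_def by meson
  have "(\<Sum>k\<in>d. norm ((g (Sup k), h (Sup k)) - (g (Inf k), h (Inf k)))) < \<epsilon>"
    if d: "d division_of \<Union>d" "\<Union>d \<subseteq> {a..b}" "(\<Sum>k\<in>d. Sup k - Inf k) < min \<delta>1 \<delta>2" for d
  proof -
    have "(\<Sum>k\<in>d. norm ((g (Sup k), h (Sup k)) - (g (Inf k), h (Inf k))))
        \<le> (\<Sum>k\<in>d. norm (g (Sup k) - g (Inf k)) + norm (h (Sup k) - h (Inf k)))"
      by (intro sum_mono) (simp add: norm_Pair_le)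
    then show ?thesis
      using \<delta>1[OF d(1,2)] \<delta>2[OF d(1,2)] d(3) by (simp add: sum.distrib)
  qed
  moreover have "min \<delta>1 \<delta>2 > 0" using \<open>\<delta>1 > 0\<close> \<open>\<delta>2 > 0\<close> by simp
  ultimately show "\<exists>\<delta>>0. \<forall>d. d division_of \<Union>d \<and> \<Union>d \<subseteq> {a..b} \<and>
     (\<Sum>k\<in>d. Sup k - Inf k) < \<delta> \<longrightarrow>
     (\<Sum>k\<in>d. norm ((g (Sup k), h (Sup k)) - (g (Inf k), h (Inf k)))) < \<epsilon>"
    by blast
qed

lemma abs_cont_on_diff:
  assumes "abs_cont_on a b g" "abs_cont_on a b h"
  shows "abs_cont_on a b (\<lambda>t. g t - h t)"
proof (rule abs_cont_on_dominated[OF abs_cont_on_Pair[OF assms], of 2])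
  fix s t
  have "norm (g t - h t - (g s - h s)) \<le> norm (g t - g s) + norm (h t - h s)"
    using norm_triangle_ineq4[of "g t - g s" "h t - h s"] by (simp add: algebra_simps)
  moreover have "norm (g t - g s) \<le> norm ((g t - g s, h t - h s))"
    "norm (h t - h s) \<le> norm ((g t - g s, h t - h s))"
    by (rule norm_fst_le, rule norm_snd_le)
  ultimately show "norm (g t - h t - (g s - h s)) \<le> 2 * norm ((g t, h t) - (g s, h s))"
    by simp
qed simp

lemma abs_cont_on_subinterval:
  assumes "abs_cont_on a b g" "{a'..b'} \<subseteq> {a..b}"
  shows "abs_cont_on a' b' g"
  using assms unfolding abs_cont_on_def by (meson order_trans)

lemma abs_cont_on_continuous:
  assumes "abs_cont_on a b g"
  shows "continuous_on {a..b} g"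
  unfolding continuous_on_iff
proof (intro ballI allI impI)
  fix t \<epsilon> :: real assume t: "t \<in> {a..b}" and "\<epsilon> > 0"
  then obtain \<delta> where "\<delta> > 0" and \<delta>: "\<And>d. d division_of \<Union>d \<Longrightarrow> \<Union>d \<subseteq> {a..b} \<Longrightarrow>
     (\<Sum>k\<in>d. Sup k - Inf k) < \<delta> \<Longrightarrow> (\<Sum>k\<in>d. norm (g (Sup k) - g (Inf k))) < \<epsilon>"
    using assms unfolding abs_cont_on_def by meson
  have close: "norm (g v - g u) < \<epsilon>" if "u \<in> {a..b}" "v \<in> {a..b}" "u \<le> v" "v - u < \<delta>" for u v
  proof -
    have "{{u..v}} division_of \<Union>{{u..v}}"
      using that division_of_self[of u v] by (simp add: box_real)
    then show ?thesis
      using \<delta>[of "{{u..v}}"] that by auto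
  qed
  have "dist (g s) (g t) < \<epsilon>" if "s \<in> {a..b}" "dist s t < \<delta>" for s
    using close[of s t] close[of t s] that t
    by (cases "s \<le> t") (auto simp: dist_norm norm_minus_commute)
  with \<open>\<delta> > 0\<close> show "\<exists>d>0. \<forall>s\<in>{a..b}. dist s t < d \<longrightarrow> dist (g s) (g t) < \<epsilon>"
    by blast
qed

text \<open>The straddle form of differentiability compares the two end points of an interval around
  the point of differentiation, as Riemann sums need.\<close>
lemma has_vector_derivative_straddle:
  assumes "(g has_vector_derivative g') (at t within S)" "e > 0"
  obtains \<delta> where "\<delta> > 0"
    "\<And>u v. u \<in> S \<Longrightarrow> v \<in> S \<Longrightarrow> u \<le> t \<Longrightarrow> t \<le> v \<Longrightarrow> \<bar>u - t\<bar> < \<delta> \<Longrightarrow> \<bar>v - t\<bar> < \<delta> \<Longrightarrow>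
       norm ((v - u) *\<^sub>R g' - (g v - g u)) \<le> e * (v - u)"
proof -
  obtain \<delta> where "\<delta> > 0" and \<delta>: "\<And>y. y \<in> S \<Longrightarrow> norm (y - t) < \<delta> \<Longrightarrow>
      norm (g y - g t - (y - t) *\<^sub>R g') \<le> e * norm (y - t)"
    using assms unfolding has_vector_derivative_def has_derivative_within_alt by blast
  show thesis
  proof (rule that[OF \<open>\<delta> > 0\<close>])
    fix u v assume uv: "u \<in> S" "v \<in> S" "u \<le> t" "t \<le> v" "\<bar>u - t\<bar> < \<delta>" "\<bar>v - t\<bar> < \<delta>"
    have "norm ((v - u) *\<^sub>R g' - (g v - g u))
        = norm ((g u - g t - (u - t) *\<^sub>R g') - (g v - g t - (v - t) *\<^sub>R g'))"
      by (simp add: algebra_simps)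
    also have "\<dots> \<le> e * norm (u - t) + e * norm (v - t)"
      by (rule order_trans[OF norm_triangle_ineq4 add_mono]; use \<delta>[of u] \<delta>[of v] uv in simp)
    also have "\<dots> = e * (v - u)"
      using uv by (simp add: algebra_simps)
    finally show "norm ((v - u) *\<^sub>R g' - (g v - g u)) \<le> e * (v - u)" .
  qed
qed

text \<open>The gauge treats two kinds of tags. At a point of differentiability it forces the
  increment over an interval to be close to the derivative times the length. The exceptional null set is
  covered by an open set of measure less than the \<open>\<delta>\<close> of absolute continuity, and intervals tagged there
  stay inside this open set; so their increments have a small sum, while the integrand can be taken to
  be zero at their tags.\<close>
theorem abs_cont_on_has_integral:
  fixes g :: "real \<Rightarrow> 'b::real_normed_vector"
  assumes "a \<le> b" and ac: "abs_cont_on a b g"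
    and der: "AE t in lebesgue_on {a..b}. (g has_vector_derivative g' t) (at t within {a..b})"
  shows "(g' has_integral (g b - g a)) {a..b}"
proof -
  define N where "N = {t \<in> {a..b}. \<not> (g has_vector_derivative g' t) (at t within {a..b})}"
  have N: "negligible N"
    using der unfolding N_def by (subst (asm) AE_lebesgue_on_iff_negligible) auto
  define h where "h t = (if t \<in> N then 0 else g' t)" for t
  have "(h has_integral (g b - g a)) {a..b}"
    unfolding has_integral_real
  proof (intro allI impI)
    fix e :: real assume "e > 0"
    \<comment> \<open>The summand \<open>1\<close> keeps the denominator positive when \<open>a = b\<close>.\<close>
    define e1 where "e1 = e / (2 * (b - a + 1))"
    have "e1 > 0" and e1: "e1 * (b - a) < e / 2"
      using \<open>e > 0\<close> \<open>a \<le> b\<close> unfolding e1_def by (auto simp: field_simps)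
    obtain \<delta> where "\<delta> > 0" and \<delta>: "\<And>d. d division_of \<Union>d \<Longrightarrow> \<Union>d \<subseteq> {a..b} \<Longrightarrow>
       (\<Sum>k\<in>d. Sup k - Inf k) < \<delta> \<Longrightarrow> (\<Sum>k\<in>d. norm (g (Sup k) - g (Inf k))) < e / 2"
      using ac \<open>e > 0\<close> unfolding abs_cont_on_def by (meson half_gt_zero)
    obtain U where U: "open U" "N \<subseteq> U" "U - N \<in> lmeasurable" "emeasure lebesgue (U - N) < ennreal \<delta>"
      using sets_lebesgue_outer_open[of N \<delta>] N \<open>\<delta> > 0\<close> by (metis negligible_imp_sets)
    have "U = (U - N) \<union> N" using U by auto
    then have Um: "U \<in> lmeasurable"
      using U(3) N by (metis negligible_imp_measurable fmeasurable.Un)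
    have "measure lebesgue U = measure lebesgue (U - N)"
      using \<open>U = (U - N) \<union> N\<close> N U(3)
      by (metis Un_Diff_cancel2 measure_negligible_symdiff Un_commute fmeasurableD measure_Un_null_set negligible_iff_null_sets)
    also have "\<dots> < \<delta>"
      using U(3,4) \<open>\<delta> > 0\<close> by (simp add: emeasure_eq_measure2 ennreal_less_iff)
    finally have Usmall: "measure lebesgue U < \<delta>" .
    have "\<exists>r>0. \<forall>u v. u \<in> {a..b} \<longrightarrow> v \<in> {a..b} \<longrightarrow> u \<le> t \<longrightarrow> t \<le> v \<longrightarrow> \<bar>u - t\<bar> < r \<longrightarrow>
        \<bar>v - t\<bar> < r \<longrightarrow> norm ((v - u) *\<^sub>R g' t - (g v - g u)) \<le> e1 * (v - u)"
      if "t \<in> {a..b} - N" for t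
    proof -
      have "(g has_vector_derivative g' t) (at t within {a..b})"
        using that by (simp add: N_def)
      then show ?thesis
        using has_vector_derivative_straddle[OF _ \<open>e1 > 0\<close>] by metis
    qed
    then obtain r where r: "\<And>t. t \<in> {a..b} - N \<Longrightarrow> r t > 0"
      "\<And>t u v. t \<in> {a..b} - N \<Longrightarrow> u \<in> {a..b} \<Longrightarrow> v \<in> {a..b} \<Longrightarrow> u \<le> t \<Longrightarrow> t \<le> v \<Longrightarrow>
        \<bar>u - t\<bar> < r t \<Longrightarrow> \<bar>v - t\<bar> < r t \<Longrightarrow>
        norm ((v - u) *\<^sub>R g' t - (g v - g u)) \<le> e1 * (v - u)"
      by metis
    define \<gamma> where "\<gamma> t = (if t \<in> N then U else if t \<in> {a..b} then ball t (r t) else ball t 1)" for t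
    have gauge: "gauge \<gamma>"
      using U(1,2) r(1) by (auto simp: gauge_def \<gamma>_def)
    have close: "norm ((\<Sum>(x,k)\<in>p. measure lborel k *\<^sub>R h x) - (g b - g a)) < e"
      if p: "p tagged_division_of {a..b}" and fine: "\<gamma> fine p" for p
    proof -
      note pD = tagged_division_ofD[OF p]
      define P where "P = {(x,k) \<in> p. x \<in> N}"
      have Pp: "P \<subseteq> p" and "finite P" "finite p"
        using pD(1) by (auto simp: P_def intro: finite_subset)
      have ends: "Inf k \<in> {a..b} \<and> Sup k \<in> {a..b} \<and> Inf k \<le> x \<and> x \<le> Sup k \<and> k = {Inf k..Sup k}
          \<and> measure lborel k = Sup k - Inf k"
        if "(x,k) \<in> p" for x k
      proof -
        note e = division_of_interval_ends[OF division_of_tagged_division[OF p] order_refl, of k]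
        have k: "k \<in> snd ` p" using that by force
        have "measure lborel k = Sup k - Inf k"
          using e(3,4)[OF k] content_real[of "Inf k" "Sup k"] by simp
        then show ?thesis
          using e[OF k] pD(2)[OF that] by (metis atLeastAtMost_iff)
      qed
      let ?\<Delta> = "\<lambda>k. g (Sup k) - g (Inf k)"
      have tel: "(\<Sum>(x,k)\<in>p. ?\<Delta> k) = g b - g a"
        using additive_tagged_division_1[OF \<open>a \<le> b\<close> p, of g] by simp
      have tel1: "(\<Sum>(x,k)\<in>p. Sup k - Inf k) = b - a"
        using additive_tagged_division_1[OF \<open>a \<le> b\<close> p, of "\<lambda>t. t"] by simp
      have "(\<Sum>(x,k)\<in>p. measure lborel k *\<^sub>R h x) - (g b - g a)
          = (\<Sum>(x,k)\<in>p. measure lborel k *\<^sub>R h x - ?\<Delta> k)"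
        unfolding tel[symmetric] by (simp add: sum_subtractf case_prod_unfold)
      also have "\<dots> = (\<Sum>(x,k)\<in>p - P. measure lborel k *\<^sub>R h x - ?\<Delta> k) + (\<Sum>(x,k)\<in>P. measure lborel k *\<^sub>R h x - ?\<Delta> k)"
        by (rule sum.subset_diff[OF Pp \<open>finite p\<close>])
      finally have split: "(\<Sum>(x,k)\<in>p. measure lborel k *\<^sub>R h x) - (g b - g a)
          = (\<Sum>(x,k)\<in>p - P. measure lborel k *\<^sub>R h x - ?\<Delta> k) + (\<Sum>(x,k)\<in>P. measure lborel k *\<^sub>R h x - ?\<Delta> k)" .
      have "norm (\<Sum>(x,k)\<in>p - P. measure lborel k *\<^sub>R h x - ?\<Delta> k)
          \<le> (\<Sum>(x,k)\<in>p - P. e1 * (Sup k - Inf k))"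
      proof (rule sum_norm_le, clarify)
        fix x k assume xk: "(x,k) \<in> p" "(x,k) \<notin> P"
        then have x: "x \<in> {a..b} - N" using pD(2,3)[OF xk(1)] by (auto simp: P_def)
        have "k \<subseteq> ball x (r x)" using fineD[OF fine xk(1)] x by (auto simp: \<gamma>_def)
        moreover have "Inf k \<in> k" "Sup k \<in> k"
          using ends[OF xk(1)] by (metis atLeastAtMost_iff order_trans order_refl)+
        ultimately have "\<bar>Inf k - x\<bar> < r x" "\<bar>Sup k - x\<bar> < r x"
          by (metis dist_real_def abs_minus_commute mem_ball subsetD)+
        then show "norm (measure lborel k *\<^sub>R h x - ?\<Delta> k) \<le> e1 * (Sup k - Inf k)"
          using r(2)[OF x] ends[OF xk(1)] x by (simp add: h_def)
      qed
      also have "\<dots> \<le> (\<Sum>(x,k)\<in>p. e1 * (Sup k - Inf k))"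
        using ends \<open>e1 > 0\<close> \<open>finite p\<close> by (intro sum_mono2) (auto intro!: mult_nonneg_nonneg dest!: ends)
      also have "\<dots> = e1 * (b - a)"
        unfolding tel1[symmetric] by (simp add: sum_distrib_left case_prod_unfold)
      also have "\<dots> < e / 2" by (rule e1)
      finally have good: "norm (\<Sum>(x,k)\<in>p - P. measure lborel k *\<^sub>R h x - ?\<Delta> k) < e / 2" .
      have Ppart: "P tagged_partial_division_of {a..b}"
        using tagged_partial_division_subset[OF _ Pp] p by (simp add: tagged_division_of_def)
      note Pdiv = partial_division_of_tagged_division[OF Ppart]
      have Usub: "\<Union>(snd ` P) \<subseteq> {a..b}" using pD(3) Pp by force
      have "(\<Sum>k\<in>snd ` P. Sup k - Inf k) = (\<Sum>k\<in>snd ` P. measure lebesgue k)"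
      proof (rule sum.cong[OF refl])
        fix k assume "k \<in> snd ` P"
        then obtain x where "(x,k) \<in> p" using Pp by auto
        note e = ends[OF this]
        then have "k \<in> sets lborel" by (metis sets_lborel atLeastAtMost_borel)
        then show "Sup k - Inf k = measure lebesgue k" using e by simp
      qed
      also have "\<dots> = measure lebesgue (\<Union>(snd ` P))"
        by (rule content_division[OF Pdiv])
      also have "\<dots> \<le> measure lebesgue U"
      proof (rule measure_mono_fmeasurable[OF _ _ Um])
        show "\<Union>(snd ` P) \<subseteq> U" using fine by (force simp: P_def fine_def \<gamma>_def)
        show "\<Union>(snd ` P) \<in> sets lebesgue"
          using lmeasurable_division[OF Pdiv] by (rule fmeasurableD)
      qed
      finally have "(\<Sum>k\<in>snd ` P. Sup k - Inf k) < \<delta>" using Usmall by simp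
      then have small: "(\<Sum>k\<in>snd ` P. norm (?\<Delta> k)) < e / 2"
        by (rule \<delta>[OF Pdiv Usub])
      have "norm (\<Sum>(x,k)\<in>P. measure lborel k *\<^sub>R h x - ?\<Delta> k) \<le> (\<Sum>(x,k)\<in>P. norm (?\<Delta> k))"
        by (rule sum_norm_le) (auto simp: P_def h_def norm_minus_commute)
      \<comment> \<open>An interval can carry two tags only if it is degenerate; its increment is then \<open>0\<close>.\<close>
      also have "\<dots> = (\<Sum>(x,k)\<in>P. if k = {} then 0 else norm (?\<Delta> k))"
        by (intro sum.cong) (auto dest!: pD(2)[OF subsetD[OF Pp]])
      also have "\<dots> = (\<Sum>k\<in>snd ` P. if k = {} then 0 else norm (?\<Delta> k))"
      proof (rule sum.over_tagged_division_lemma[OF tagged_partial_division_of_Union_self[OF Ppart]])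
        fix u v :: real assume "box u v = {}"
        then have "v \<le> u" by simp
        then show "(if cbox u v = {} then 0 else norm (?\<Delta> (cbox u v))) = 0"
          by (cases "u = v") auto
      qed
      also have "\<dots> \<le> (\<Sum>k\<in>snd ` P. norm (?\<Delta> k))"
        by (rule sum_mono) simp
      finally have "norm (\<Sum>(x,k)\<in>P. measure lborel k *\<^sub>R h x - ?\<Delta> k) < e / 2"
        using small by simp
      with good show ?thesis
        unfolding split by (intro order_le_less_trans[OF norm_triangle_ineq]) simp
    qed
    show "\<exists>\<gamma>. gauge \<gamma> \<and> (\<forall>p. p tagged_division_of {a..b} \<and> \<gamma> fine p \<longrightarrow>
        norm ((\<Sum>(x,k)\<in>p. measure lborel k *\<^sub>R h x) - (g b - g a)) < e)"
      by (intro exI[of _ \<gamma>] conjI gauge allI impI close) (erule conjunct1, erule conjunct2)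
  qed
  then show ?thesis
    by (rule has_integral_spike[OF N, rotated]) (simp add: h_def)
qed

section \<open>Gronwall's inequality, local Lipschitz bounds and gradients\<close>

text \<open>The function \<open>exp (- K t) * integral {0..t} m\<close> starts at \<open>0\<close> and has a nonpositive
  derivative, so the integral is at most \<open>0\<close>, and hence so is \<open>m\<close>.\<close>
lemma Gronwall_zero:
  fixes m :: "real \<Rightarrow> real"
  assumes cont: "continuous_on {0..T} m"
    and nonneg: "\<And>t. t \<in> {0..T} \<Longrightarrow> m t \<ge> 0" and "K \<ge> 0"
    and le: "\<And>t. t \<in> {0..T} \<Longrightarrow> m t \<le> K * integral {0..t} m"
    and t: "t \<in> {0..T}"
  shows "m t = 0"
proof -
  define I where "I s = integral {0..s} m" for s
  define G where "G s = exp (- K * s) * I s" for s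
  have dI: "(I has_real_derivative m s) (at s within {0..T})" if "s \<in> {0..T}" for s
    unfolding I_def using integral_has_real_derivative[OF cont] that by simp
  have dG: "(G has_real_derivative exp (- K * s) * (m s - K * I s)) (at s within {0..T})"
    if "s \<in> {0..T}" for s
    unfolding G_def by (rule derivative_eq_intros dI[OF that] refl)+ (simp add: algebra_simps)
  have "((\<lambda>s. exp (- K * s) * (m s - K * I s)) has_integral (G t - G 0)) {0..t}"
  proof (rule fundamental_theorem_of_calculus)
    fix s assume "s \<in> {0..t}"
    then have "(G has_real_derivative exp (- K * s) * (m s - K * I s)) (at s within {0..t})"
      using t by (intro has_field_derivative_subset[OF dG]) auto
    then show "(G has_vector_derivative exp (- K * s) * (m s - K * I s)) (at s within {0..t})"
      by (simp add: has_real_derivative_iff_has_vector_derivative)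
  qed (use t in simp)
  moreover have "exp (- K * s) * (m s - K * I s) \<le> 0" if "s \<in> {0..t}" for s
    using le[of s] that t by (auto simp: I_def mult_le_0_iff)
  ultimately have "G t - G 0 \<le> 0"
    using has_integral_le[OF _ has_integral_0] by blast
  then have "I t \<le> 0"
    by (simp add: G_def I_def mult_le_0_iff)
  then have "K * I t \<le> 0"
    using \<open>K \<ge> 0\<close> by (simp add: mult_nonneg_nonpos)
  then show ?thesis
    using le[OF t] nonneg[OF t] by (simp add: I_def)
qed

text \<open>The uniqueness principle for all differential equations below, applied to the difference
  of two solutions. With \<open>K = 0\<close> it says that an almost everywhere vanishing derivative forces an
  absolutely continuous function to be constant.\<close>
lemma abs_cont_on_Gronwall:
  fixes g :: "real \<Rightarrow> 'b::banach"
  assumes ac: "abs_cont_on 0 T g" and "g 0 = 0" and "K \<ge> 0"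
    and der: "AE t in lebesgue_on {0..T}.
      \<exists>D. (g has_vector_derivative D) (at t within {0..T}) \<and> norm D \<le> K * norm (g t)"
    and "t \<in> {0..T}"
  shows "g t = 0"
proof -
  define N where "N = {t \<in> {0..T}. \<not> (\<exists>D. (g has_vector_derivative D) (at t within {0..T})
      \<and> norm D \<le> K * norm (g t))}"
  have N: "negligible N"
    using der unfolding N_def by (subst (asm) AE_lebesgue_on_iff_negligible) auto
  have "\<exists>D. (t \<in> {0..T} - N \<longrightarrow> (g has_vector_derivative D) (at t within {0..T})) \<and>
      norm D \<le> K * norm (g t)" for t
  proof (cases "t \<in> {0..T} - N")
    case True
    then show ?thesis by (auto simp: N_def)
  next
    case False
    then show ?thesis using \<open>K \<ge> 0\<close> by (intro exI[of _ 0] conjI impI) simp_all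
  qed
  then obtain g' where g': "\<And>t. t \<in> {0..T} - N \<Longrightarrow> (g has_vector_derivative g' t) (at t within {0..T})"
    and bound: "\<And>t. norm (g' t) \<le> K * norm (g t)"
    by metis
  have cont: "continuous_on {0..T} (\<lambda>t. norm (g t))"
    by (intro continuous_on_norm abs_cont_on_continuous ac)
  have "norm (g s) \<le> K * integral {0..s} (\<lambda>t. norm (g t))" if s: "s \<in> {0..T}" for s
  proof -
    have "negligible {t \<in> {0..s}. \<not> (g has_vector_derivative g' t) (at t within {0..s})}"
    proof (rule negligible_subset[OF N], safe, rule ccontr)
      fix t assume t: "t \<in> {0..s}" "t \<notin> N" "\<not> (g has_vector_derivative g' t) (at t within {0..s})"
      have "{0..s} \<subseteq> {0..T}" using s by auto
      then show False
        using t g'[of t] has_vector_derivative_within_subset by blast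
    qed
    then have "AE t in lebesgue_on {0..s}. (g has_vector_derivative g' t) (at t within {0..s})"
      by (subst AE_lebesgue_on_iff_negligible) auto
    then have "(g' has_integral (g s - g 0)) {0..s}"
      using s by (intro abs_cont_on_has_integral abs_cont_on_subinterval[OF ac]) auto
    then have int: "(g' has_integral g s) {0..s}"
      using \<open>g 0 = 0\<close> by simp
    have "continuous_on {0..s} (\<lambda>t. norm (g t))"
      using continuous_on_subset[OF cont] s by auto
    then have "((\<lambda>t. K * norm (g t)) has_integral (K * integral {0..s} (\<lambda>t. norm (g t)))) {0..s}"
      by (intro has_integral_mult_right integrable_integral integrable_continuous_interval)
    then show ?thesis
      using integral_norm_bound_integral[of g' "{0..s}" "\<lambda>t. K * norm (g t)"] int bound
      by (metis has_integral_integrable_integral)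
  qed
  then have "norm (g t) = 0"
    using cont \<open>t \<in> {0..T}\<close> \<open>K \<ge> 0\<close> by (intro Gronwall_zero[of T "\<lambda>t. norm (g t)" K]) auto
  then show ?thesis by simp
qed

lemma C1_obtain:
  assumes "C1 g"
  obtains D where "\<And>x. (g has_derivative blinfun_apply (D x)) (at x)" "continuous_on UNIV D"
  using assms unfolding C1_def by blast

lemma C1_lipschitz_on_cball:
  fixes g :: "'a::{real_normed_vector, heine_borel} \<Rightarrow> 'b::real_normed_vector"
  assumes "C1 g"
  obtains K where "K-lipschitz_on (cball 0 R) g"
proof -
  obtain D where D: "\<And>x. (g has_derivative blinfun_apply (D x)) (at x)" "continuous_on UNIV D"
    using C1_obtain[OF assms] by blast
  have "compact (D ` cball 0 R)"
    using D(2) by (intro compact_continuous_image compact_cball) (rule continuous_on_subset, auto)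
  then obtain K where K: "\<And>x. x \<in> cball 0 R \<Longrightarrow> norm (D x) \<le> K"
    by (meson bounded_iff compact_imp_bounded imageI)
  have "(max K 0)-lipschitz_on (cball 0 R) g"
  proof (rule bounded_derivative_imp_lipschitz)
    fix x assume x: "x \<in> cball (0::'a) R"
    show "(g has_derivative blinfun_apply (D x)) (at x within cball 0 R)"
      using D(1) has_derivative_at_withinI by blast
    show "onorm (blinfun_apply (D x)) \<le> max K 0"
      using K[OF x] by (simp add: norm_blinfun.rep_eq)
  qed auto
  then show thesis by (rule that)
qed

text \<open>The Lipschitz condition on balls around each point is the autonomous case of
  \<^const>\<open>local_lipschitz\<close>; the time variable is a dummy ranging over a single point.\<close>
lemma locally_lipschitz_lipschitz_on_compact:
  fixes g :: "'a::metric_space \<Rightarrow> 'b::metric_space"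
  assumes "locally_lipschitz g" "compact S"
  obtains K where "K-lipschitz_on S g"
proof -
  have "local_lipschitz {0::real} S (\<lambda>_. g)"
    unfolding local_lipschitz_def
  proof (intro ballI)
    fix p t assume "p \<in> S" "t \<in> {0::real}"
    obtain r K where "r > 0" and K: "K-lipschitz_on (ball p r) g"
      using assms(1) unfolding locally_lipschitz_def by blast
    have "K-lipschitz_on (cball p (r / 2) \<inter> S) g"
      by (rule lipschitz_on_subset[OF K]) (use \<open>r > 0\<close> in auto)
    then show "\<exists>u>0. \<exists>L. \<forall>t\<in>cball t u \<inter> {0}. L-lipschitz_on (cball p u \<inter> S) g"
      using \<open>r > 0\<close> half_gt_zero by blast
  qed
  then show thesis
    using local_lipschitz_compact_implies_lipschitz[OF _ assms(2), of "{0::real}" "\<lambda>_. g"] that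
    by (metis continuous_on_const compact_sing singletonI)
qed

text \<open>The Riesz representation theorem. The representing vector is a multiple of the point \<open>p\<close>
  of least norm on the hyperplane \<open>l = 1\<close>, which exists as closed bounded sets are compact. Minimality
  in the directions \<open>w\<close> and \<open>- w\<close> makes \<open>p\<close> orthogonal to the kernel of \<open>l\<close>.\<close>
lemma bounded_functional_representation:
  fixes l :: "'a::{real_inner, heine_borel} \<Rightarrow> real"
  assumes "bounded_linear l"
  obtains v where "\<And>x. l x = x \<bullet> v"
proof (cases "\<forall>x. l x = 0")
  case True
  then show thesis using that[of 0] by simp
next
  case False
  interpret bounded_linear l by fact
  define S where "S = {x. l x = 1}"
  have "S \<noteq> {}"
  proof -
    obtain x where "l x \<noteq> 0" using False by blast
    then have "x /\<^sub>R l x \<in> S" by (simp add: S_def scale)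
    then show ?thesis by blast
  qed
  have "closed S"
    unfolding S_def by (intro closed_Collect_eq continuous_on_const linear_continuous_on assms)
  have "convex S"
    by (auto simp: S_def convex_def add scale)
  obtain p where p: "p \<in> S" "\<forall>x\<in>S. dist 0 p \<le> dist 0 x"
    using distance_attains_inf[OF \<open>closed S\<close> \<open>S \<noteq> {}\<close>, of 0] by metis
  have orth: "w \<bullet> p = 0" if "l w = 0" for w
  proof -
    have pw: "p + w \<in> S" "p - w \<in> S" using p(1) that by (simp_all add: S_def add diff)
    have "(0 - p) \<bullet> (p + w - p) \<le> 0" "(0 - p) \<bullet> (p - w - p) \<le> 0"
      by (rule any_closest_point_dot[OF \<open>convex S\<close> \<open>closed S\<close> p(1) pw(1) p(2)],
          rule any_closest_point_dot[OF \<open>convex S\<close> \<open>closed S\<close> p(1) pw(2) p(2)])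
    then show ?thesis by (simp add: inner_commute)
  qed
  have "l p = 1" "p \<noteq> 0" using p(1) zero by (auto simp: S_def)
  show thesis
  proof (rule that[of "p /\<^sub>R (p \<bullet> p)"])
    fix x
    have "(x - l x *\<^sub>R p) \<bullet> p = 0" by (rule orth) (simp add: diff scale \<open>l p = 1\<close>)
    then have "x \<bullet> p = l x * (p \<bullet> p)" by (simp add: inner_diff_left)
    then show "l x = x \<bullet> (p /\<^sub>R (p \<bullet> p))" using \<open>p \<noteq> 0\<close> by simp
  qed
qed

lemma grad_unique:
  assumes "(g has_derivative l) (at x)" "\<And>h. l h = h \<bullet> v"
  shows "grad g x = v"
proof -
  have "l = (\<lambda>h. h \<bullet> v)" using assms(2) by blast
  then have "GDERIV g x :> v" using assms(1) by (simp add: gderiv_def)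
  moreover have "w = v" if "GDERIV g x :> w" for w
  proof -
    have "(\<lambda>h. h \<bullet> w) = (\<lambda>h. h \<bullet> v)"
      using that \<open>GDERIV g x :> v\<close> unfolding gderiv_def by (rule has_derivative_unique)
    then have "(w - v) \<bullet> w = (w - v) \<bullet> v" by meson
    then have "(w - v) \<bullet> (w - v) = 0" by (simp add: inner_diff_right)
    then show ?thesis by simp
  qed
  ultimately show ?thesis
    unfolding grad_def by (rule the_equality)
qed

text \<open>Existence of the gradient is the point here: \<^const>\<open>grad\<close> is a definite description, which
  means nothing until a representing vector is known to exist.\<close>
lemma has_derivative_grad:
  fixes g :: "'a::{real_inner, heine_borel} \<Rightarrow> real"
  assumes "(g has_derivative l) (at x)"
  shows "l h = grad g x \<bullet> h"
proof -
  obtain v where "\<And>h. l h = h \<bullet> v"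
    using bounded_functional_representation[OF has_derivative_bounded_linear[OF assms]] by blast
  then show ?thesis using grad_unique[OF assms] by (simp add: inner_commute)
qed

section \<open>Global solutions of ordinary differential equations\<close>

text \<open>The Picard operator is made a contraction in one stroke on all of \<open>[0,T]\<close> by measuring
  distances with the weight \<open>exp (- 2 K t)\<close>. The weight is moved into the unknown
  \<open>w t = exp (- 2 K t) y t\<close>, so that the plain supremum metric on bounded continuous functions serves;
  clipping the time to \<open>[0,T]\<close> makes these functions live on the whole line.\<close>
theorem Picard_Lindelof_global:
  fixes F :: "'a::banach \<Rightarrow> 'a"
  assumes F: "K-lipschitz_on UNIV F" and "T \<ge> 0"
  obtains y where "y 0 = y0"
    "\<And>t. t \<in> {0..T} \<Longrightarrow> (y has_vector_derivative F (y t)) (at t within {0..T})"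
proof -
  have "K \<ge> 0" using lipschitz_on_nonneg[OF F] .
  have F': "norm (F a - F b) \<le> K * norm (a - b)" for a b
    using lipschitz_onD[OF F, of a b] by (simp add: dist_norm)
  define clip where "clip t = max 0 (min T t)" for t
  have clip: "clip t \<in> {0..T}" for t using \<open>T \<ge> 0\<close> by (auto simp: clip_def)
  have clip_id: "clip t = t" if "t \<in> {0..T}" for t using that by (auto simp: clip_def)
  define h where "h w s = F (exp (2 * K * s) *\<^sub>R w s)" for w :: "real \<Rightarrow> 'a" and s
  define P where "P w \<tau> = exp (- (2 * K * \<tau>)) *\<^sub>R (y0 + integral {0..\<tau>} (h w))" for w \<tau>
  have cont_F: "continuous_on A F" for A
    using lipschitz_on_continuous_on[OF F] continuous_on_subset by blast
  have cont_h: "continuous_on {0..t} (h (apply_bcontfun w))" for w t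
    unfolding h_def by (intro continuous_on_compose2[OF cont_F] continuous_intros) auto
  have "(\<lambda>t. P (apply_bcontfun w) (clip t)) \<in> bcontfun" for w
  proof -
    have contP: "continuous_on {0..T} (P (apply_bcontfun w))"
      unfolding P_def using cont_h
      by (intro continuous_intros indefinite_integral_continuous_1 integrable_continuous_interval)
    have "continuous_on UNIV (\<lambda>t. P (apply_bcontfun w) (clip t))"
      by (rule continuous_on_compose2[OF contP])
        (use clip in \<open>auto simp: clip_def intro!: continuous_intros\<close>)
    moreover have "bounded (range (\<lambda>t. P (apply_bcontfun w) (clip t)))"
      by (rule bounded_subset[OF compact_imp_bounded[OF compact_continuous_image[OF contP compact_Icc]]])
        (use clip in blast)
    ultimately show ?thesis by (simp add: bcontfun_def)
  qed
  then have "\<exists>v. \<forall>t. apply_bcontfun v t = P (apply_bcontfun w) (clip t)" for w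
    by (metis bcontfunE)
  then obtain \<Phi> :: "(real \<Rightarrow>\<^sub>C 'a) \<Rightarrow> (real \<Rightarrow>\<^sub>C 'a)"
    where \<Phi>: "\<And>w t. apply_bcontfun (\<Phi> w) t = P (apply_bcontfun w) (clip t)"
    by metis
  have "dist (\<Phi> v) (\<Phi> w) \<le> 1 / 2 * dist v w" for v w
  proof (rule dist_bound)
    fix t
    define \<tau> where "\<tau> = clip t"
    have "\<tau> \<ge> 0" using clip[of t] by (simp add: \<tau>_def)
    let ?E = "\<lambda>s. exp (2 * K * s) * dist v w / 2"
    have "((\<lambda>s. K * exp (2 * K * s) * dist v w) has_integral (?E \<tau> - ?E 0)) {0..\<tau>}"
    proof (rule fundamental_theorem_of_calculus[OF \<open>\<tau> \<ge> 0\<close>])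
      fix s
      have "(?E has_real_derivative K * exp (2 * K * s) * dist v w) (at s within {0..\<tau>})"
        by (auto intro!: derivative_eq_intros)
      then show "(?E has_vector_derivative K * exp (2 * K * s) * dist v w) (at s within {0..\<tau>})"
        by (simp add: has_real_derivative_iff_has_vector_derivative)
    qed
    moreover have "norm (h v s - h w s) \<le> K * exp (2 * K * s) * dist v w" for s
    proof -
      have "norm (h v s - h w s) \<le> K * norm (exp (2 * K * s) *\<^sub>R (v s - w s))"
        unfolding h_def scaleR_diff_right by (rule F')
      also have "\<dots> = K * exp (2 * K * s) * dist (v s) (w s)" by (simp add: dist_norm)
      also have "\<dots> \<le> K * exp (2 * K * s) * dist v w"
        using \<open>K \<ge> 0\<close> by (intro mult_left_mono dist_bounded) auto
      finally show ?thesis .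
    qed
    moreover have hi: "h v integrable_on {0..\<tau>}" "h w integrable_on {0..\<tau>}"
      using cont_h by (auto intro: integrable_continuous_interval)
    ultimately have "norm (integral {0..\<tau>} (\<lambda>s. h v s - h w s)) \<le> ?E \<tau> - ?E 0"
      by (intro integral_norm_bound_integral[THEN order_trans[OF _ eq_refl[OF integral_unique]]]
          integrable_diff) (auto intro: has_integral_integrable)
    moreover have "?E 0 \<ge> 0" by simp
    ultimately have "norm (integral {0..\<tau>} (h v) - integral {0..\<tau>} (h w)) \<le> ?E \<tau>"
      unfolding integral_diff[OF hi] by linarith
    then have "exp (- (2 * K * \<tau>)) * norm (integral {0..\<tau>} (h v) - integral {0..\<tau>} (h w))
        \<le> exp (- (2 * K * \<tau>)) * ?E \<tau>"
      using zero_le_dist[of v w] by (intro mult_left_mono) simp_all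
    also have "\<dots> = 1 / 2 * dist v w" by (simp add: exp_minus)
    finally have "norm (exp (- (2 * K * \<tau>)) *\<^sub>R (integral {0..\<tau>} (h v) - integral {0..\<tau>} (h w)))
        \<le> 1 / 2 * dist v w" by simp
    moreover have "P v \<tau> - P w \<tau> = exp (- (2 * K * \<tau>)) *\<^sub>R (integral {0..\<tau>} (h v) - integral {0..\<tau>} (h w))"
      by (simp add: P_def scaleR_diff_right scaleR_add_right)
    ultimately show "dist (\<Phi> v t) (\<Phi> w t) \<le> 1 / 2 * dist v w"
      by (simp add: \<Phi> dist_norm \<tau>_def)
  qed
  then obtain w where w: "\<Phi> w = w"
    using banach_fix_type[of "1 / 2" \<Phi>] by auto
  define y where "y t = exp (2 * K * t) *\<^sub>R w t" for t
  have y: "y t = y0 + integral {0..t} (\<lambda>s. F (y s))" if "t \<in> {0..T}" for t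
  proof -
    have "w t = P w t" using \<Phi>[of w t] clip_id[OF that] by (simp add: w)
    then show ?thesis by (simp add: y_def P_def h_def[abs_def] exp_minus)
  qed
  show thesis
  proof (rule that)
    show "y 0 = y0" using y[of 0] \<open>T \<ge> 0\<close> by simp
    fix t assume t: "t \<in> {0..T}"
    have "continuous_on {0..T} (\<lambda>s. F (y s))"
      using cont_h[of T w] by (simp add: h_def y_def)
    then have I: "((\<lambda>t. y0 + integral {0..t} (\<lambda>s. F (y s))) has_vector_derivative F (y t)) (at t within {0..T})"
      using integral_has_vector_derivative[OF _ t] by (auto intro!: derivative_eq_intros)
    show "(y has_vector_derivative F (y t)) (at t within {0..T})"
      by (rule has_vector_derivative_transform[OF t _ I]) (rule y)
  qed
qed

text \<open>Composing the field with the nearest-point retraction onto the ball makes it globally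
  Lipschitz. The solution of the modified equation solves the original one up to the first time at which
  it could reach the sphere, and the a priori bound forbids that time.\<close>
theorem solution_exists_if_a_priori_bounded:
  fixes F :: "'a::{real_inner, heine_borel, banach} \<Rightarrow> 'a"
  assumes F: "K-lipschitz_on (cball 0 R) F" and "T \<ge> 0" and "norm y0 < R"
    and a_priori: "\<And>t y. t \<in> {0..T} \<Longrightarrow> y 0 = y0 \<Longrightarrow>
      (\<And>s. s \<in> {0..t} \<Longrightarrow> (y has_vector_derivative F (y s)) (at s within {0..t})) \<Longrightarrow>
      norm (y t) < R"
  obtains y where "y 0 = y0"
    "\<And>t. t \<in> {0..T} \<Longrightarrow> (y has_vector_derivative F (y t)) (at t within {0..T})"
proof -
  let ?\<pi> = "closest_point (cball (0::'a) R)"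
  have "R > 0" using \<open>norm y0 < R\<close> norm_ge_zero[of y0] by linarith
  then have ne: "cball (0::'a) R \<noteq> {}" by simp
  have \<pi>: "?\<pi> a \<in> cball 0 R" for a
    by (rule closest_point_in_set[OF closed_cball ne])
  have "K-lipschitz_on UNIV (\<lambda>a. F (?\<pi> a))"
  proof (rule lipschitz_onI)
    fix a b
    have "dist (F (?\<pi> a)) (F (?\<pi> b)) \<le> K * dist (?\<pi> a) (?\<pi> b)"
      using lipschitz_onD[OF F] \<pi> by blast
    also have "\<dots> \<le> K * dist a b"
      using closest_point_lipschitz[OF convex_cball closed_cball ne] lipschitz_on_nonneg[OF F]
      by (intro mult_left_mono) auto
    finally show "dist (F (?\<pi> a)) (F (?\<pi> b)) \<le> K * dist a b" .
  qed (rule lipschitz_on_nonneg[OF F])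
  then obtain y where y0: "y 0 = y0"
    and y: "\<And>t. t \<in> {0..T} \<Longrightarrow> (y has_vector_derivative F (?\<pi> (y t))) (at t within {0..T})"
    using Picard_Lindelof_global[OF _ \<open>T \<ge> 0\<close>] by metis
  have cont: "continuous_on {0..T} (\<lambda>t. norm (y t))"
    using y by (intro continuous_on_norm continuous_on_vector_derivative)
  have inside: "norm (y t) < R" if "t \<in> {0..T}" for t
  proof (rule ccontr)
    assume "\<not> norm (y t) < R"
    define S where "S = {t \<in> {0..T}. R \<le> norm (y t)}"
    have "closed S"
      using continuous_closed_preimage[OF cont closed_atLeastAtMost closed_atLeast, of R]
      by (simp add: S_def vimage_def Int_def)
    moreover have "S \<noteq> {}" "bdd_below S"
      using that \<open>\<not> norm (y t) < R\<close> by (auto simp: S_def intro: bdd_belowI[of _ 0])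
    ultimately have "Inf S \<in> S" by (intro closed_contains_Inf)
    then obtain t1 where t1: "t1 = Inf S" "t1 \<in> {0..T}" "R \<le> norm (y t1)" by (auto simp: S_def)
    have "t1 > 0" using t1 y0 \<open>norm y0 < R\<close> by (cases "t1 = 0") auto
    have before: "norm (y s) \<le> R" if "s \<in> {0..<t1}" for s
    proof (rule ccontr)
      assume "\<not> norm (y s) \<le> R"
      then have "s \<in> S" using that t1(2) by (auto simp: S_def)
      then have "t1 \<le> s" unfolding t1(1) by (rule cInf_lower) fact
      then show False using that by simp
    qed
    have upto: "norm (y s) \<le> R" if "s \<in> {0..t1}" for s
    proof (rule continuous_le_on_closure[where S = "{0..<t1}" and f = "\<lambda>t. norm (y t)"])
      show "s \<in> closure {0..<t1}" using that \<open>t1 > 0\<close> by simp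
      show "continuous_on (closure {0..<t1}) (\<lambda>t. norm (y t))"
        using continuous_on_subset[OF cont] \<open>t1 > 0\<close> t1(2) by simp
    qed (rule before)
    have "norm (y t1) < R"
    proof (rule a_priori[of t1 y, OF t1(2) y0])
      fix s assume s: "s \<in> {0..t1}"
      have "?\<pi> (y s) = y s" using upto[OF s] by (intro closest_point_self) simp
      then show "(y has_vector_derivative F (y s)) (at s within {0..t1})"
        using has_vector_derivative_within_subset[OF y, of s "{0..t1}"] s t1(2) by auto
    qed
    then show False using t1(3) by simp
  qed
  show thesis
  proof (rule that[of y])
    fix t assume t: "t \<in> {0..T}"
    have "?\<pi> (y t) = y t"
      using inside[OF t] by (intro closest_point_self) simp
    then show "(y has_vector_derivative F (y t)) (at t within {0..T})"
      using y[OF t] by simp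
  qed (rule y0)
qed

section \<open>Absolutely continuous curves and bounded gradients\<close>

lemma has_vector_derivative_compose_derivative:
  assumes "(W has_derivative l) (at (y t))" "(y has_vector_derivative y') (at t within S)"
  shows "((\<lambda>s. W (y s)) has_vector_derivative l y') (at t within S)"
  using vector_derivative_diff_chain_within[OF assms(2), of W l] has_derivative_at_withinI[OF assms(1)]
  by (simp add: o_def)

lemma continuous_image_in_cball:
  fixes y :: "real \<Rightarrow> 'b::real_normed_vector"
  assumes "continuous_on {a..b} y"
  obtains R where "y ` {a..b} \<subseteq> cball 0 R"
  using compact_imp_bounded[OF compact_continuous_image[OF assms compact_Icc]]
  by (auto simp: bounded_iff subset_iff)

lemma C1_compose_abs_cont_on:
  fixes W :: "'b::{real_normed_vector, heine_borel} \<Rightarrow> 'c::real_normed_vector"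
  assumes "C1 W" and y: "abs_cont_on a b y"
  shows "abs_cont_on a b (\<lambda>t. W (y t))"
proof -
  obtain R where "y ` {a..b} \<subseteq> cball 0 R"
    using continuous_image_in_cball[OF abs_cont_on_continuous[OF y]] by blast
  moreover obtain K where "K-lipschitz_on (cball 0 R) W"
    using C1_lipschitz_on_cball[OF \<open>C1 W\<close>] by blast
  ultimately show ?thesis
    using abs_cont_on_compose_lipschitz[OF y] by blast
qed

lemma C1_continuous_on: "C1 g \<Longrightarrow> continuous_on A g"
  by (elim C1_obtain) (meson continuous_at_imp_continuous_on has_derivative_continuous)

text \<open>A continuous derivative on a compact interval is bounded, so the function is Lipschitz.\<close>
lemma has_vector_derivative_imp_abs_cont_on:
  fixes y :: "real \<Rightarrow> 'b::real_normed_vector"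
  assumes y: "\<And>t. t \<in> {a..b} \<Longrightarrow> (y has_vector_derivative y' t) (at t within {a..b})"
    and "continuous_on {a..b} y'"
  shows "abs_cont_on a b y"
proof -
  obtain R where R: "y' ` {a..b} \<subseteq> cball 0 R"
    using continuous_image_in_cball[OF assms(2)] by blast
  have "(max R 0)-lipschitz_on {a..b} y"
  proof (rule bounded_derivative_imp_lipschitz)
    fix t assume t: "t \<in> {a..b}"
    show "(y has_derivative (\<lambda>h. h *\<^sub>R y' t)) (at t within {a..b})"
      using y[OF t] by (simp add: has_vector_derivative_def)
    show "onorm (\<lambda>h. h *\<^sub>R y' t) \<le> max R 0"
    proof (rule onorm_bound)
      fix h :: real
      have "norm (y' t) \<le> max R 0" using R t by (fastforce simp: image_subset_iff)
      then show "norm (h *\<^sub>R y' t) \<le> max R 0 * norm h"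
        by (simp add: mult.commute mult_left_mono)
    qed simp
  qed auto
  then show ?thesis by (rule lipschitz_imp_abs_cont_on)
qed

text \<open>Two solutions on a compact interval stay in a common ball, on which the field has one
  Lipschitz constant.\<close>
lemma abs_cont_ODE_unique:
  fixes F :: "'a::{banach, heine_borel} \<Rightarrow> 'a"
  assumes F: "\<And>R. \<exists>K. K-lipschitz_on (cball 0 R) F"
    and y: "abs_cont_on 0 T y" "AE t in lebesgue_on {0..T}. (y has_vector_derivative F (y t)) (at t within {0..T})"
    and w: "abs_cont_on 0 T w" "AE t in lebesgue_on {0..T}. (w has_vector_derivative F (w t)) (at t within {0..T})"
    and "y 0 = w 0" and t: "t \<in> {0..T}"
  shows "y t = w t"
proof -
  obtain Ry where Ry: "y ` {0..T} \<subseteq> cball 0 Ry"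
    using continuous_image_in_cball[OF abs_cont_on_continuous[OF y(1)]] by blast
  obtain Rw where Rw: "w ` {0..T} \<subseteq> cball 0 Rw"
    using continuous_image_in_cball[OF abs_cont_on_continuous[OF w(1)]] by blast
  obtain K where K: "K-lipschitz_on (cball 0 (max Ry Rw)) F" using F by blast
  have "y t - w t = 0"
  proof (rule abs_cont_on_Gronwall[OF abs_cont_on_diff[OF y(1) w(1)] _ lipschitz_on_nonneg[OF K] _ t])
    show "AE t in lebesgue_on {0..T}. \<exists>D. ((\<lambda>t. y t - w t) has_vector_derivative D) (at t within {0..T}) \<and>
        norm D \<le> K * norm (y t - w t)"
      using y(2) w(2) AE_space[of "lebesgue_on {0..T}"]
    proof eventually_elim
      case (elim t)
      then have "y t \<in> cball 0 (max Ry Rw)" "w t \<in> cball 0 (max Ry Rw)" using Ry Rw by fastforce+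
      then have "norm (F (y t) - F (w t)) \<le> K * norm (y t - w t)"
        using lipschitz_onD[OF K, of "y t" "w t"] by (simp add: dist_norm)
      moreover have "((\<lambda>t. y t - w t) has_vector_derivative F (y t) - F (w t)) (at t within {0..T})"
        using elim by (intro has_vector_derivative_diff)
      ultimately show ?case by blast
    qed
  qed (use \<open>y 0 = w 0\<close> in simp)
  then show ?thesis by simp
qed

text \<open>A step of length \<open>1 / (2 L)\<close> against the gradient lowers \<open>f\<close> by at least
  \<open>\<parallel>\<nabla>f\<parallel>\<^sup>2 / (4 L)\<close>, since the gradient loses at most half of its component along the step; and \<open>f\<close>
  cannot drop below its infimum.\<close>
lemma gradient_bound_of_lipschitz_gradient:
  fixes f :: "'a::{real_inner, heine_borel} \<Rightarrow> real"
  assumes f: "\<And>x. (f has_derivative (\<lambda>h. grad f x \<bullet> h)) (at x)"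
    and L: "L-lipschitz_on UNIV (grad f)" and "L > 0" and bdd: "bdd_below (range f)"
  shows "(norm (grad f x))\<^sup>2 \<le> 4 * L * (f x - (INF y. f y))"
proof -
  define s where "s = 1 / (2 * L)"
  have "s > 0" using \<open>L > 0\<close> by (simp add: s_def)
  let ?g = "grad f x"
  let ?p = "\<lambda>r. x - r *\<^sub>R ?g"
  have der: "((\<lambda>r. f (?p r)) has_real_derivative - (grad f (?p r) \<bullet> ?g)) (at r)" for r
  proof -
    have "(?p has_vector_derivative - ?g) (at r within UNIV)"
      by (auto intro!: derivative_eq_intros)
    from has_vector_derivative_compose_derivative[where y = ?p, OF f this]
    show ?thesis by (simp add: has_real_derivative_iff_has_vector_derivative)
  qed
  obtain r where r: "0 < r" "r < s" "f (?p s) - f (?p 0) = (s - 0) * - (grad f (?p r) \<bullet> ?g)"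
    using MVT2[OF \<open>s > 0\<close> der] by blast
  have "(?g - grad f (?p r)) \<bullet> ?g \<le> norm (?g - grad f (?p r)) * norm ?g"
    by (rule norm_cauchy_schwarz)
  also have "\<dots> \<le> (L * norm (r *\<^sub>R ?g)) * norm ?g"
    using lipschitz_onD[OF L, of x "?p r"] by (intro mult_right_mono) (simp_all add: dist_norm)
  also have "\<dots> = (L * r) * (norm ?g)\<^sup>2" using r by (simp add: power2_eq_square)
  also have "\<dots> \<le> 1 / 2 * (norm ?g)\<^sup>2"
    using r \<open>L > 0\<close> by (intro mult_right_mono) (auto simp: s_def field_simps)
  finally have "1 / 2 * (norm ?g)\<^sup>2 \<le> grad f (?p r) \<bullet> ?g"
    by (simp add: inner_diff_left power2_norm_eq_inner)
  then have "s * (1 / 2 * (norm ?g)\<^sup>2) \<le> s * (grad f (?p r) \<bullet> ?g)"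
    using \<open>s > 0\<close> by (intro mult_left_mono) auto
  moreover have "(INF y. f y) \<le> f (?p s)" using bdd by (intro cINF_lower) auto
  ultimately have "s * (1 / 2 * (norm ?g)\<^sup>2) \<le> f x - (INF y. f y)"
    using r(3) by simp
  then show ?thesis using \<open>L > 0\<close> by (simp add: s_def field_simps)
qed

section \<open>Energy along controlled trajectories\<close>

lemma partial_derivatives:
  assumes W: "((\<lambda>(x, z). W x z) has_derivative l) (at (x, z))"
  shows "((\<lambda>x'. W x' z) has_derivative (\<lambda>h. l (h, 0))) (at x)"
    and "((\<lambda>z'. W x z') has_derivative (\<lambda>k. l (0, k))) (at z)"
    and "l (h, k) = l (h, 0) + l (0, k)"
proof -
  have "((\<lambda>x'. (x', z)) has_derivative (\<lambda>h. (h, 0))) (at x)"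
    by (auto intro!: derivative_eq_intros)
  from has_derivative_compose[OF this, of "\<lambda>(x, z). W x z" l] W
  show "((\<lambda>x'. W x' z) has_derivative (\<lambda>h. l (h, 0))) (at x)" by simp
  have "((\<lambda>z'. (x, z')) has_derivative (\<lambda>k. (0, k))) (at z)"
    by (auto intro!: derivative_eq_intros)
  from has_derivative_compose[OF this, of "\<lambda>(x, z). W x z" l] W
  show "((\<lambda>z'. W x z') has_derivative (\<lambda>k. l (0, k))) (at z)" by simp
  interpret bounded_linear l using W by (rule has_derivative_bounded_linear)
  show "l (h, k) = l (h, 0) + l (0, k)"
    using add[of "(h, 0)" "(0, k)"] by simp
qed

lemma solutionD:
  assumes "solution q \<alpha> T s0 u x z e"
  shows "abs_cont_on 0 T x" "abs_cont_on 0 T z" "abs_cont_on 0 T e" "(x 0, z 0, e 0) = s0"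
    "AE t in lebesgue_on {0..T}.
        (x has_vector_derivative \<alpha> (x t) (z t) + e t) (at t within {0..T}) \<and>
        (z has_vector_derivative q (x t) (z t)) (at t within {0..T}) \<and>
        (e has_vector_derivative u t - alpha_dot q \<alpha> (x t) (z t) (e t)) (at t within {0..T})"
proof -
  note s = assms[unfolded solution_def]
  show "abs_cont_on 0 T x" using s by (rule conjunct1)
  show "abs_cont_on 0 T z" using s[THEN conjunct2] by (rule conjunct1)
  show "abs_cont_on 0 T e" using s[THEN conjunct2, THEN conjunct2] by (rule conjunct1)
  show "(x 0, z 0, e 0) = s0"
    using s[THEN conjunct2, THEN conjunct2, THEN conjunct2] by (rule conjunct1)
  show "AE t in lebesgue_on {0..T}.
        (x has_vector_derivative \<alpha> (x t) (z t) + e t) (at t within {0..T}) \<and>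
        (z has_vector_derivative q (x t) (z t)) (at t within {0..T}) \<and>
        (e has_vector_derivative u t - alpha_dot q \<alpha> (x t) (z t) (e t)) (at t within {0..T})"
    using s[THEN conjunct2, THEN conjunct2, THEN conjunct2] by (rule conjunct2)
qed

locale backstepping =
  fixes f :: "'a::euclidean_space \<Rightarrow> real"
    and q :: "'a \<Rightarrow> 'z::{real_inner, heine_borel, banach} \<Rightarrow> 'z"
    and \<alpha> :: "'a \<Rightarrow> 'z \<Rightarrow> 'a"
    and V\<^sub>1 :: "'a \<Rightarrow> 'z \<Rightarrow> real"
    and L c\<^sub>\<phi> c\<^sub>z \<sigma> lam c :: real
  assumes f_C2: "C2 f"
    and grad_lipschitz: "L-lipschitz_on UNIV (grad f)"
    and f_bdd_below: "bdd_below (range f)"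
    and q_lipschitz: "locally_lipschitz (\<lambda>(x, z). q x z)"
    and V1_C1: "C1 (\<lambda>(x, z). V\<^sub>1 x z)"
    and V1_lower: "V\<^sub>1 x z \<ge> c\<^sub>\<phi> * (f x - (INF y. f y)) + c\<^sub>z * (norm z)\<^sup>2"
    and V1_decay: "grad (\<lambda>x'. V\<^sub>1 x' z) x \<bullet> (\<alpha> x z + e) + grad (\<lambda>z'. V\<^sub>1 x z') z \<bullet> q x z =
           - \<sigma> * (norm (grad f x))\<^sup>2 + lam * (grad f x \<bullet> e)"
    and \<alpha>_C1: "C1 (\<lambda>(x, z). \<alpha> x z)"
    and \<alpha>_bounded: "R > 0 \<Longrightarrow> bounded {\<alpha> x z | x z. norm (grad f x) \<le> R \<and> norm z \<le> R}"
    and pos: "c\<^sub>\<phi> > 0" "c\<^sub>z > 0" "\<sigma> > 0" "c > 0"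
begin

definition V :: "'a \<Rightarrow> 'z \<Rightarrow> 'a \<Rightarrow> real" where
  "V x z e = V\<^sub>1 x z + 1 / 2 * (norm e)\<^sup>2"

definition feedback :: "'a \<Rightarrow> 'z \<Rightarrow> 'a \<Rightarrow> 'a" where
  "feedback x z e = alpha_dot q \<alpha> x z e - c *\<^sub>R e - lam *\<^sub>R grad f x"

text \<open>The derivative of \<open>V\<close> along the flow with input \<open>u\<close>; see \<open>energy_balance\<close>.\<close>
definition V_dot :: "'a \<Rightarrow> 'z \<Rightarrow> 'a \<Rightarrow> 'a \<Rightarrow> real" where
  "V_dot x z e u =
     - \<sigma> * (norm (grad f x))\<^sup>2 + e \<bullet> (u - alpha_dot q \<alpha> x z e + lam *\<^sub>R grad f x)"

lemma completion_of_squares: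
  "running_cost f q \<alpha> \<sigma> lam c x z e u + V_dot x z e u
    = 1 / (2 * c) * (norm (u - feedback x z e))\<^sup>2"
proof -
  define w where "w = u - alpha_dot q \<alpha> x z e + lam *\<^sub>R grad f x"
  have "u - feedback x z e = w + c *\<^sub>R e" by (simp add: w_def feedback_def)
  then have "(norm (u - feedback x z e))\<^sup>2 = (norm w)\<^sup>2 + 2 * c * (e \<bullet> w) + c\<^sup>2 * (norm e)\<^sup>2"
    unfolding power2_norm_eq_inner
    by (simp add: inner_add_left inner_add_right inner_commute[of w e] power2_eq_square algebra_simps)
  then have "1 / (2 * c) * (norm (u - feedback x z e))\<^sup>2
      = 1 / (2 * c) * (norm w)\<^sup>2 + e \<bullet> w + c / 2 * (norm e)\<^sup>2"
    using pos(4) by (simp add: distrib_left power2_eq_square[of c])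
  then show ?thesis
    unfolding running_cost_def V_dot_def w_def[symmetric] by simp
qed

lemma V_dot_feedback:
  "V_dot x z e (feedback x z e) = - \<sigma> * (norm (grad f x))\<^sup>2 - c * (norm e)\<^sup>2"
proof -
  have "feedback x z e - alpha_dot q \<alpha> x z e + lam *\<^sub>R grad f x = - (c *\<^sub>R e)"
    by (simp add: feedback_def)
  then show ?thesis by (simp only: V_dot_def) (simp add: power2_norm_eq_inner)
qed

lemma f_has_derivative: "(f has_derivative (\<lambda>h. grad f x \<bullet> h)) (at x)"
proof -
  obtain D where D: "(f has_derivative blinfun_apply (D x)) (at x)"
    using f_C2 unfolding C2_def by blast
  moreover have "blinfun_apply (D x) = (\<lambda>h. grad f x \<bullet> h)"
    using has_derivative_grad[OF D] by blast
  ultimately show ?thesis by simp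
qed

lemma continuous_on_grad: "continuous_on A (grad f)"
  by (rule continuous_on_subset[OF lipschitz_on_continuous_on[OF grad_lipschitz] subset_UNIV])

text \<open>The decay hypothesis speaks of the two partial gradients; what the chain rule needs is the
  total derivative of \<open>V\<^sub>1\<close> in the direction of the flow.\<close>
lemma V1_derivative_along_flow:
  obtains l where "((\<lambda>(x, z). V\<^sub>1 x z) has_derivative l) (at (x, z))"
    "\<And>e. l (\<alpha> x z + e, q x z) = - \<sigma> * (norm (grad f x))\<^sup>2 + lam * (grad f x \<bullet> e)"
proof -
  obtain D where D: "\<And>p. ((\<lambda>(x, z). V\<^sub>1 x z) has_derivative blinfun_apply (D p)) (at p)"
    using C1_obtain[OF V1_C1] by blast
  note parts = partial_derivatives[OF D[of "(x, z)"]]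
  show thesis
  proof (rule that[OF D])
    fix e
    show "blinfun_apply (D (x, z)) (\<alpha> x z + e, q x z)
        = - \<sigma> * (norm (grad f x))\<^sup>2 + lam * (grad f x \<bullet> e)"
      unfolding parts(3)[of "\<alpha> x z + e" "q x z"] has_derivative_grad[OF parts(1)] has_derivative_grad[OF parts(2)]
      by (rule V1_decay)
  qed
qed

lemma alpha_dot_eq:
  assumes "((\<lambda>(x, z). \<alpha> x z) has_derivative l) (at (x, z))"
  shows "alpha_dot q \<alpha> x z e = l (\<alpha> x z + e, q x z)"
  unfolding alpha_dot_def partial_derivatives(3)[OF assms, of "\<alpha> x z + e" "q x z"]
    frechet_derivative_at[OF partial_derivatives(1)[OF assms], symmetric]
    frechet_derivative_at[OF partial_derivatives(2)[OF assms], symmetric] ..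

lemma q_continuous_on: "continuous_on A (\<lambda>(x, z). q x z)"
proof -
  have "isCont (\<lambda>(x, z). q x z) p" for p
  proof -
    obtain r K where "r > 0" "K-lipschitz_on (ball p r) (\<lambda>(x, z). q x z)"
      using q_lipschitz unfolding locally_lipschitz_def by blast
    then show ?thesis
      using lipschitz_on_continuous_on continuous_on_interior interior_ball centre_in_ball
      by metis
  qed
  then show ?thesis by (simp add: continuous_at_imp_continuous_on)
qed

lemma continuous_on_alpha_dot:
  assumes "continuous_on A x" "continuous_on A z" "continuous_on A e"
  shows "continuous_on A (\<lambda>t. alpha_dot q \<alpha> (x t) (z t) (e t))"
proof -
  obtain D where D: "\<And>p. ((\<lambda>(x, z). \<alpha> x z) has_derivative blinfun_apply (D p)) (at p)"
      "continuous_on UNIV D"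
    using C1_obtain[OF \<alpha>_C1] by blast
  have xz: "continuous_on A (\<lambda>t. (x t, z t))" using assms by (intro continuous_intros)
  have "continuous_on A (\<lambda>t. D (x t, z t))"
    by (rule continuous_on_compose2[OF D(2) xz]) simp
  moreover have "continuous_on A (\<lambda>t. \<alpha> (x t) (z t))"
    using continuous_on_compose2[OF C1_continuous_on[OF \<alpha>_C1] xz, of UNIV] by simp
  moreover have "continuous_on A (\<lambda>t. q (x t) (z t))"
    using continuous_on_compose2[OF q_continuous_on xz, of UNIV] by simp
  ultimately show ?thesis
    unfolding alpha_dot_eq[OF D(1)] using assms by (intro continuous_intros)
qed

lemma continuous_on_feedback:
  assumes "continuous_on A x" "continuous_on A z" "continuous_on A e"
  shows "continuous_on A (\<lambda>t. feedback (x t) (z t) (e t))"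
proof -
  have g: "continuous_on A (\<lambda>t. grad f (x t))"
    using continuous_on_compose[OF assms(1) continuous_on_grad] by (simp only: o_def)
  show ?thesis
    unfolding feedback_def
    by (rule continuous_on_diff[OF continuous_on_diff[OF continuous_on_alpha_dot[OF assms]
          continuous_on_scaleR[OF continuous_on_const assms(3)]]
        continuous_on_scaleR[OF continuous_on_const g]])
qed

lemma solution_continuous_on:
  assumes "solution q \<alpha> T s0 u x z e"
  shows "continuous_on {0..T} x" "continuous_on {0..T} z" "continuous_on {0..T} e"
  using solutionD(1-3)[OF assms] by (simp_all add: abs_cont_on_continuous)

text \<open>Both summands of \<open>V\<close> are absolutely continuous along a trajectory. The cross term
  \<open>lam * (grad f x \<bullet> e)\<close> in the derivative of \<open>V\<^sub>1\<close> is what the last summand inside \<open>V_dot\<close> accounts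
  for.\<close>
lemma energy_balance:
  assumes "T \<ge> 0" and sol: "solution q \<alpha> T s0 u x z e"
  shows "((\<lambda>t. V_dot (x t) (z t) (e t) (u t)) has_integral
    (V (x T) (z T) (e T) - V (x 0) (z 0) (e 0))) {0..T}"
proof -
  note x = solutionD(1)[OF sol] and z = solutionD(2)[OF sol] and e = solutionD(3)[OF sol]
    and der = solutionD(5)[OF sol]
  have "((\<lambda>t. - \<sigma> * (norm (grad f (x t)))\<^sup>2 + lam * (grad f (x t) \<bullet> e t)) has_integral
      (V\<^sub>1 (x T) (z T) - V\<^sub>1 (x 0) (z 0))) {0..T}"
  proof (rule abs_cont_on_has_integral[OF \<open>T \<ge> 0\<close>])
    show "abs_cont_on 0 T (\<lambda>t. V\<^sub>1 (x t) (z t))"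
      using C1_compose_abs_cont_on[OF V1_C1 abs_cont_on_Pair[OF x z]] by simp
    show "AE t in lebesgue_on {0..T}. ((\<lambda>t. V\<^sub>1 (x t) (z t)) has_vector_derivative
        - \<sigma> * (norm (grad f (x t)))\<^sup>2 + lam * (grad f (x t) \<bullet> e t)) (at t within {0..T})"
      using der
    proof eventually_elim
      case (elim t)
      obtain l where l: "((\<lambda>(x, z). V\<^sub>1 x z) has_derivative l) (at (x t, z t))"
        "\<And>\<epsilon>. l (\<alpha> (x t) (z t) + \<epsilon>, q (x t) (z t)) =
           - \<sigma> * (norm (grad f (x t)))\<^sup>2 + lam * (grad f (x t) \<bullet> \<epsilon>)"
        using V1_derivative_along_flow[of "x t" "z t"] by blast
      have "((\<lambda>t. (x t, z t)) has_vector_derivative (\<alpha> (x t) (z t) + e t, q (x t) (z t)))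
          (at t within {0..T})"
        using elim by (intro has_vector_derivative_Pair) auto
      from has_vector_derivative_compose_derivative[where y = "\<lambda>t. (x t, z t)", OF l(1) this]
      show ?case unfolding l(2) by simp
    qed
  qed
  moreover have "((\<lambda>t. e t \<bullet> (u t - alpha_dot q \<alpha> (x t) (z t) (e t))) has_integral
      (1 / 2 * (norm (e T))\<^sup>2 - 1 / 2 * (norm (e 0))\<^sup>2)) {0..T}"
  proof (rule abs_cont_on_has_integral[OF \<open>T \<ge> 0\<close>])
    obtain R where R: "e ` {0..T} \<subseteq> cball 0 R"
      using continuous_image_in_cball[OF abs_cont_on_continuous[OF e]] by blast
    have "(max R 0)-lipschitz_on (cball 0 R) (\<lambda>v::'a. 1 / 2 * (norm v)\<^sup>2)"
    proof (rule bounded_derivative_imp_lipschitz)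
      fix v :: 'a assume v: "v \<in> cball 0 R"
      show "((\<lambda>v. 1 / 2 * (norm v)\<^sup>2) has_derivative (\<lambda>h. v \<bullet> h)) (at v within cball 0 R)"
        unfolding power2_norm_eq_inner
        by (auto intro!: derivative_eq_intros simp: inner_commute)
      show "onorm (\<lambda>h. v \<bullet> h) \<le> max R 0"
      proof (rule onorm_bound)
        fix h
        have "norm (v \<bullet> h) \<le> norm v * norm h" by (simp add: Cauchy_Schwarz_ineq2)
        also have "\<dots> \<le> max R 0 * norm h" using v by (intro mult_right_mono) auto
        finally show "norm (v \<bullet> h) \<le> max R 0 * norm h" .
      qed simp
    qed auto
    then show "abs_cont_on 0 T (\<lambda>t. 1 / 2 * (norm (e t))\<^sup>2)"
      by (rule abs_cont_on_compose_lipschitz[OF e _ R])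
    show "AE t in lebesgue_on {0..T}. ((\<lambda>t. 1 / 2 * (norm (e t))\<^sup>2) has_vector_derivative
        e t \<bullet> (u t - alpha_dot q \<alpha> (x t) (z t) (e t))) (at t within {0..T})"
      using der
    proof eventually_elim
      case (elim t)
      have "((\<lambda>v. 1 / 2 * (norm v)\<^sup>2) has_derivative (\<lambda>h. e t \<bullet> h)) (at (e t))"
        unfolding power2_norm_eq_inner
        by (auto intro!: derivative_eq_intros simp: inner_commute)
      then show ?case
        using has_vector_derivative_compose_derivative elim by blast
    qed
  qed
  ultimately have "((\<lambda>t. - \<sigma> * (norm (grad f (x t)))\<^sup>2 + lam * (grad f (x t) \<bullet> e t)
        + e t \<bullet> (u t - alpha_dot q \<alpha> (x t) (z t) (e t))) has_integral
      (V\<^sub>1 (x T) (z T) - V\<^sub>1 (x 0) (z 0) + (1 / 2 * (norm (e T))\<^sup>2 - 1 / 2 * (norm (e 0))\<^sup>2))) {0..T}"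
    by (rule has_integral_add)
  then show ?thesis
    by (simp add: V_dot_def V_def inner_add_right inner_commute algebra_simps)
qed

text \<open>In the coordinate \<open>\<alpha> x z + e\<close>, whose derivative is \<open>u\<close> itself, uniqueness can be read off in
  cascade: first the velocity, then \<open>x\<close>, then \<open>z\<close> by the local Lipschitz condition on \<open>q\<close>, and finally
  \<open>e\<close>.\<close>
lemma open_loop_unique:
  assumes s: "solution q \<alpha> T s0 u x z e" and s': "solution q \<alpha> T s0 u x' z' e'"
    and t: "t \<in> {0..T}"
  shows "x t = x' t" "z t = z' t" "e t = e' t"
proof -
  note ac = solutionD(1-3)[OF s] solutionD(1-3)[OF s']
    and der = solutionD(5)[OF s] and der' = solutionD(5)[OF s']
  have init: "x 0 = x' 0" "z 0 = z' 0" "e 0 = e' 0"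
    using solutionD(4)[OF s] solutionD(4)[OF s'] by auto
  \<comment> \<open>The derivative of \<open>\<alpha>\<close> along the trajectory cancels the one subtracted in the equation for \<open>e\<close>.\<close>
  have velocity: "((\<lambda>s. \<alpha> (\<xi> s) (\<zeta> s) + \<epsilon> s) has_vector_derivative u t) (at t within {0..T})"
    if "(\<xi> has_vector_derivative \<alpha> (\<xi> t) (\<zeta> t) + \<epsilon> t) (at t within {0..T}) \<and>
        (\<zeta> has_vector_derivative q (\<xi> t) (\<zeta> t)) (at t within {0..T}) \<and>
        (\<epsilon> has_vector_derivative u t - alpha_dot q \<alpha> (\<xi> t) (\<zeta> t) (\<epsilon> t)) (at t within {0..T})"
    for \<xi> \<zeta> \<epsilon> t
  proof -
    obtain l where l: "((\<lambda>(x, z). \<alpha> x z) has_derivative l) (at (\<xi> t, \<zeta> t))"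
      using C1_obtain[OF \<alpha>_C1] by blast
    have "((\<lambda>t. (\<xi> t, \<zeta> t)) has_vector_derivative (\<alpha> (\<xi> t) (\<zeta> t) + \<epsilon> t, q (\<xi> t) (\<zeta> t)))
        (at t within {0..T})"
      using that by (intro has_vector_derivative_Pair) auto
    from has_vector_derivative_compose_derivative[where y = "\<lambda>t. (\<xi> t, \<zeta> t)", OF l this]
    have "((\<lambda>s. \<alpha> (\<xi> s) (\<zeta> s)) has_vector_derivative alpha_dot q \<alpha> (\<xi> t) (\<zeta> t) (\<epsilon> t)) (at t within {0..T})"
      unfolding alpha_dot_eq[OF l] by simp
    from has_vector_derivative_add[OF this conjunct2[OF conjunct2[OF that]]]
    show ?thesis by simp
  qed
  have ac\<alpha>: "abs_cont_on 0 T (\<lambda>t. \<alpha> (x t) (z t))" "abs_cont_on 0 T (\<lambda>t. \<alpha> (x' t) (z' t))"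
    using C1_compose_abs_cont_on[OF \<alpha>_C1 abs_cont_on_Pair] ac by auto
  have "abs_cont_on 0 T (\<lambda>t. (\<alpha> (x t) (z t) + e t) - (\<alpha> (x' t) (z' t) + e' t))"
    using abs_cont_on_diff[OF abs_cont_on_diff[OF ac\<alpha>] abs_cont_on_diff[OF ac(6,3)]]
    by (simp add: algebra_simps)
  then have v: "(\<alpha> (x t) (z t) + e t) - (\<alpha> (x' t) (z' t) + e' t) = 0" if "t \<in> {0..T}" for t
  proof (rule abs_cont_on_Gronwall[OF _ _ order_refl _ that])
    show "AE t in lebesgue_on {0..T}. \<exists>D. ((\<lambda>t. (\<alpha> (x t) (z t) + e t) - (\<alpha> (x' t) (z' t) + e' t))
        has_vector_derivative D) (at t within {0..T}) \<and>
        norm D \<le> 0 * norm ((\<alpha> (x t) (z t) + e t) - (\<alpha> (x' t) (z' t) + e' t))"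
      using der der'
    proof eventually_elim
      case (elim t)
      show ?case
        by (rule exI[of _ 0]) (use has_vector_derivative_diff[OF velocity[OF elim(1)] velocity[OF elim(2)]] in simp)
    qed
  qed (simp add: init)
  have x: "x t - x' t = 0" if "t \<in> {0..T}" for t
  proof (rule abs_cont_on_Gronwall[OF abs_cont_on_diff[OF ac(1,4)] _ order_refl _ that])
    show "AE t in lebesgue_on {0..T}. \<exists>D. ((\<lambda>t. x t - x' t)
        has_vector_derivative D) (at t within {0..T}) \<and> norm D \<le> 0 * norm (x t - x' t)"
      using der der' AE_space[of "lebesgue_on {0..T}"]
    proof eventually_elim
      case (elim t)
      then have "((\<lambda>t. x t - x' t) has_vector_derivative
          (\<alpha> (x t) (z t) + e t) - (\<alpha> (x' t) (z' t) + e' t)) (at t within {0..T})"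
        by (intro has_vector_derivative_diff) auto
      moreover have "t \<in> {0..T}" using elim(3) by simp
      ultimately show ?case using v[of t] by (intro exI[of _ 0]) simp
    qed
  qed (simp add: init)
  have z: "z t - z' t = 0" if "t \<in> {0..T}" for t
  proof -
    let ?S = "(\<lambda>t. (x t, z t)) ` {0..T} \<union> (\<lambda>t. (x' t, z' t)) ` {0..T}"
    have "compact ?S"
      using ac by (intro compact_Un compact_continuous_image continuous_intros abs_cont_on_continuous) auto
    then obtain K where K: "K-lipschitz_on ?S (\<lambda>(x, z). q x z)"
      using locally_lipschitz_lipschitz_on_compact[OF q_lipschitz] by blast
    show ?thesis
    proof (rule abs_cont_on_Gronwall[OF abs_cont_on_diff[OF ac(2,5)] _ lipschitz_on_nonneg[OF K] _ that])
      show "AE t in lebesgue_on {0..T}. \<exists>D. ((\<lambda>t. z t - z' t)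
        has_vector_derivative D) (at t within {0..T}) \<and> norm D \<le> K * norm (z t - z' t)"
        using der der' AE_space[of "lebesgue_on {0..T}"]
      proof eventually_elim
        case (elim t)
        then have "t \<in> {0..T}" by simp
        then have "dist (q (x t) (z t)) (q (x' t) (z' t)) \<le> K * dist (x t, z t) (x' t, z' t)"
          using lipschitz_onD[OF K, of "(x t, z t)" "(x' t, z' t)"] by auto
        then have "norm (q (x t) (z t) - q (x' t) (z' t)) \<le> K * norm (z t - z' t)"
          using x[OF \<open>t \<in> {0..T}\<close>] by (simp add: dist_norm)
        moreover have "((\<lambda>t. z t - z' t) has_vector_derivative
            q (x t) (z t) - q (x' t) (z' t)) (at t within {0..T})"
          using elim by (intro has_vector_derivative_diff) auto
        ultimately show ?case by blast
      qed
    qed (simp add: init)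
  qed
  show "x t = x' t" "z t = z' t" "e t = e' t" using x[OF t] z[OF t] v[OF t] by auto
qed

end

section \<open>The closed loop\<close>

context backstepping begin

text \<open>The feedback cancels the total derivative of \<open>\<alpha>\<close>, so the third component has no derivative
  of \<open>\<alpha>\<close> left in it.\<close>
definition closed_loop :: "'a \<times> 'z \<times> 'a \<Rightarrow> 'a \<times> 'z \<times> 'a" where
  "closed_loop = (\<lambda>(x, z, e). (\<alpha> x z + e, q x z, - (c *\<^sub>R e) - lam *\<^sub>R grad f x))"

lemma closed_loop_lipschitz: "\<exists>K. K-lipschitz_on (cball 0 R) closed_loop"
proof -
  obtain K\<alpha> where K\<alpha>: "K\<alpha>-lipschitz_on (cball 0 R) (\<lambda>(x, z). \<alpha> x z)"
    using C1_lipschitz_on_cball[OF \<alpha>_C1] by blast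
  obtain Kq where Kq: "Kq-lipschitz_on (cball 0 R) (\<lambda>(x, z). q x z)"
    using locally_lipschitz_lipschitz_on_compact[OF q_lipschitz compact_cball] by blast
  note nonneg = lipschitz_on_nonneg[OF K\<alpha>] lipschitz_on_nonneg[OF Kq] lipschitz_on_nonneg[OF grad_lipschitz]
  have shrink: "norm (x, z) \<le> norm (x, z, e)" "norm x \<le> norm (x, z, e)" "norm e \<le> norm (x, z, e)"
    for x :: 'a and z :: 'z and e :: 'a
  proof -
    show "norm (x, z) \<le> norm (x, z, e)" by (simp add: norm_Pair)
    show "norm x \<le> norm (x, z, e)" by (rule norm_fst_le)
    have "norm e \<le> norm (z, e)" by (rule norm_snd_le)
    also have "\<dots> \<le> norm (x, z, e)" by (rule norm_snd_le)
    finally show "norm e \<le> norm (x, z, e)" .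
  qed
  have "((K\<alpha> + 1) + (Kq + (c + \<bar>lam\<bar> * L)))-lipschitz_on (cball 0 R) closed_loop"
  proof (rule lipschitz_onI)
    fix s s' :: "'a \<times> 'z \<times> 'a" assume s: "s \<in> cball 0 R" and s': "s' \<in> cball 0 R"
    obtain x z e x' z' e' where eq: "s = (x, z, e)" "s' = (x', z', e')" by (metis prod_cases3)
    define d where "d = dist s s'"
    have d: "norm (x - x', z - z') \<le> d" "norm (x - x') \<le> d" "norm (e - e') \<le> d"
      using shrink(1,2)[of "x - x'" "z - z'" "e - e'"] shrink(3)[of "e - e'" "x - x'" "z - z'"]
      by (simp_all add: d_def eq dist_norm)
    have in_ball: "(x, z) \<in> cball 0 R" "(x', z') \<in> cball 0 R"
      using s s' order_trans[OF shrink(1)] by (auto simp: eq)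
    have "norm (\<alpha> x z - \<alpha> x' z') \<le> K\<alpha> * norm (x - x', z - z')"
      using lipschitz_onD[OF K\<alpha> in_ball] by (simp add: dist_norm)
    also have "\<dots> \<le> K\<alpha> * d" using d(1) nonneg(1) by (rule mult_left_mono)
    finally have 1: "norm (\<alpha> x z + e - (\<alpha> x' z' + e')) \<le> K\<alpha> * d + d"
      using d(3) norm_triangle_ineq[of "\<alpha> x z - \<alpha> x' z'" "e - e'"] by (simp add: add_diff_add)
    have "norm (q x z - q x' z') \<le> Kq * norm (x - x', z - z')"
      using lipschitz_onD[OF Kq in_ball] by (simp add: dist_norm)
    also have "\<dots> \<le> Kq * d" using d(1) nonneg(2) by (rule mult_left_mono)
    finally have 2: "norm (q x z - q x' z') \<le> Kq * d" .
    have "norm (grad f x - grad f x') \<le> L * norm (x - x')"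
      using lipschitz_onD[OF grad_lipschitz] by (simp add: dist_norm)
    also have "\<dots> \<le> L * d" using d(2) nonneg(3) by (rule mult_left_mono)
    finally have "\<bar>lam\<bar> * norm (grad f x - grad f x') \<le> \<bar>lam\<bar> * (L * d)"
      by (rule mult_left_mono) simp
    moreover have "c * norm (e - e') \<le> c * d" using d(3) pos(4) by (intro mult_left_mono) auto
    moreover have "norm (- (c *\<^sub>R e) - lam *\<^sub>R grad f x - (- (c *\<^sub>R e') - lam *\<^sub>R grad f x'))
        = norm (c *\<^sub>R (e - e') + lam *\<^sub>R (grad f x - grad f x'))"
      by (subst norm_minus_cancel[symmetric]) (simp add: algebra_simps)
    moreover have "\<dots> \<le> c * norm (e - e') + \<bar>lam\<bar> * norm (grad f x - grad f x')"
      using pos(4) by (intro order_trans[OF norm_triangle_ineq]) simp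
    ultimately have 3: "norm (- (c *\<^sub>R e) - lam *\<^sub>R grad f x - (- (c *\<^sub>R e') - lam *\<^sub>R grad f x'))
        \<le> c * d + \<bar>lam\<bar> * (L * d)" by linarith
    have "dist (closed_loop s) (closed_loop s')
        \<le> norm (\<alpha> x z + e - (\<alpha> x' z' + e')) + (norm (q x z - q x' z') +
          norm (- (c *\<^sub>R e) - lam *\<^sub>R grad f x - (- (c *\<^sub>R e') - lam *\<^sub>R grad f x')))"
      unfolding closed_loop_def eq dist_norm prod.case diff_Pair
      by (intro order_trans[OF norm_Pair_le] add_left_mono norm_Pair_le)
    also have "\<dots> \<le> (K\<alpha> * d + d) + (Kq * d + (c * d + \<bar>lam\<bar> * (L * d)))"
      by (intro add_mono 1 2 3)
    also have "\<dots> = ((K\<alpha> + 1) + (Kq + (c + \<bar>lam\<bar> * L))) * d"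
      by (simp add: algebra_simps)
    finally show "dist (closed_loop s) (closed_loop s')
        \<le> ((K\<alpha> + 1) + (Kq + (c + \<bar>lam\<bar> * L))) * dist s s'"
      unfolding d_def .
  qed (use nonneg pos(4) in simp)
  then show ?thesis ..
qed

lemma feedback_solution_derivative:
  assumes sol: "solution q \<alpha> T s0 u x z e"
    and u: "AE t in lebesgue_on {0..T}. u t = feedback (x t) (z t) (e t)"
  shows "AE t in lebesgue_on {0..T}. ((\<lambda>t. (x t, z t, e t)) has_vector_derivative
    closed_loop (x t, z t, e t)) (at t within {0..T})"
  using solutionD(5)[OF sol] u
proof eventually_elim
  case (elim t)
  have "u t - alpha_dot q \<alpha> (x t) (z t) (e t) = - (c *\<^sub>R e t) - lam *\<^sub>R grad f (x t)"
    using elim(2) by (simp add: feedback_def)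
  then show ?case
    using elim(1) by (auto simp: closed_loop_def intro!: has_vector_derivative_Pair)
qed

text \<open>The two controls are not assumed equal: each of them only follows the feedback law along its
  own trajectory.\<close>
lemma closed_loop_unique:
  assumes s: "solution q \<alpha> T s0 u x z e" "AE t in lebesgue_on {0..T}. u t = feedback (x t) (z t) (e t)"
    and s': "solution q \<alpha> T s0 u' x' z' e'" "AE t in lebesgue_on {0..T}. u' t = feedback (x' t) (z' t) (e' t)"
    and t: "t \<in> {0..T}"
  shows "(x t, z t, e t) = (x' t, z' t, e' t)"
proof (rule abs_cont_ODE_unique[OF closed_loop_lipschitz _ feedback_solution_derivative[OF s]
      _ feedback_solution_derivative[OF s'] _ t])
  show "abs_cont_on 0 T (\<lambda>t. (x t, z t, e t))"
    by (intro abs_cont_on_Pair solutionD[OF s(1)])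
  show "abs_cont_on 0 T (\<lambda>t. (x' t, z' t, e' t))"
    by (intro abs_cont_on_Pair solutionD[OF s'(1)])
  show "(x 0, z 0, e 0) = (x' 0, z' 0, e' 0)"
    using solutionD(4)[OF s(1)] solutionD(4)[OF s'(1)] by simp
qed

lemma closed_loop_curve_solution:
  assumes y: "\<And>s. s \<in> {0..t} \<Longrightarrow>
    (y has_vector_derivative closed_loop (y s)) (at s within {0..t})"
  defines "x \<equiv> \<lambda>s. fst (y s)" and "z \<equiv> \<lambda>s. fst (snd (y s))" and "e \<equiv> \<lambda>s. snd (snd (y s))"
  shows "solution q \<alpha> t (y 0) (\<lambda>s. feedback (x s) (z s) (e s)) x z e"
proof -
  have cont: "continuous_on {0..t} y"
    using y by (rule continuous_on_vector_derivative)
  obtain R where R: "y ` {0..t} \<subseteq> cball 0 R"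
    using continuous_image_in_cball[OF cont] by blast
  obtain K where "K-lipschitz_on (cball 0 R) closed_loop"
    using closed_loop_lipschitz by blast
  then have cont': "continuous_on {0..t} (\<lambda>s. closed_loop (y s))"
    by (intro continuous_on_compose2[OF lipschitz_on_continuous_on cont R])
  have ac: "abs_cont_on 0 t y"
    by (rule has_vector_derivative_imp_abs_cont_on[OF _ cont']) (rule y)
  have "(x has_vector_derivative \<alpha> (x s) (z s) + e s) (at s within {0..t}) \<and>
      (z has_vector_derivative q (x s) (z s)) (at s within {0..t}) \<and>
      (e has_vector_derivative feedback (x s) (z s) (e s) - alpha_dot q \<alpha> (x s) (z s) (e s))
        (at s within {0..t})" if "s \<in> {0..t}" for s
  proof -
    have cl: "closed_loop (y s) = (\<alpha> (x s) (z s) + e s, q (x s) (z s),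
        feedback (x s) (z s) (e s) - alpha_dot q \<alpha> (x s) (z s) (e s))"
      by (simp add: closed_loop_def feedback_def x_def z_def e_def case_prod_unfold)
    note d1 = bounded_linear.has_vector_derivative[OF bounded_linear_fst y[OF that]]
    note d2 = bounded_linear.has_vector_derivative[OF bounded_linear_snd y[OF that]]
    note d21 = bounded_linear.has_vector_derivative[OF bounded_linear_fst d2]
    note d22 = bounded_linear.has_vector_derivative[OF bounded_linear_snd d2]
    show ?thesis
      using d1 d21 d22 unfolding cl by (simp add: x_def z_def e_def)
  qed
  then have "AE s in lebesgue_on {0..t}.
      (x has_vector_derivative \<alpha> (x s) (z s) + e s) (at s within {0..t}) \<and>
      (z has_vector_derivative q (x s) (z s)) (at s within {0..t}) \<and>
      (e has_vector_derivative feedback (x s) (z s) (e s) - alpha_dot q \<alpha> (x s) (z s) (e s))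
        (at s within {0..t})"
    by (intro AE_I2) simp
  moreover have "abs_cont_on 0 t x" "abs_cont_on 0 t z" "abs_cont_on 0 t e"
    unfolding x_def z_def e_def using ac by (intro abs_cont_on_fst abs_cont_on_snd; assumption)+
  moreover have "(x 0, z 0, e 0) = y 0" by (simp add: x_def z_def e_def)
  ultimately show ?thesis
    unfolding solution_def by (intro conjI)
qed

lemma V_nonincreasing_closed_loop:
  assumes "t \<ge> 0" and sol: "solution q \<alpha> t s0 (\<lambda>s. feedback (x s) (z s) (e s)) x z e"
  shows "V (x t) (z t) (e t) \<le> V (x 0) (z 0) (e 0)"
proof -
  have "V_dot (x s) (z s) (e s) (feedback (x s) (z s) (e s)) \<le> 0" for s
  proof -
    have "\<sigma> * (norm (grad f (x s)))\<^sup>2 \<ge> 0" "c * (norm (e s))\<^sup>2 \<ge> 0" using pos(3,4) by simp_all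
    then show ?thesis unfolding V_dot_feedback by linarith
  qed
  then have "V (x t) (z t) (e t) - V (x 0) (z 0) (e 0) \<le> 0"
    using has_integral_le[OF energy_balance[OF assms] has_integral_0] by blast
  then show ?thesis by simp
qed

text \<open>The lower bound on \<open>V\<^sub>1\<close> makes \<open>V\<close> a sum of three nonnegative parts, each of which is
  therefore at most \<open>E\<close>. There is no bound on \<open>x\<close> itself, only on the gradient at \<open>x\<close>.\<close>
lemma sublevel_bounds:
  assumes "V x z e \<le> E"
  shows "norm z \<le> sqrt (E / c\<^sub>z)" "norm e \<le> sqrt (2 * E)"
    "norm (grad f x) \<le> sqrt (4 * (L + 1) * (E / c\<^sub>\<phi>))"
proof -
  have f: "f x - (INF y. f y) \<ge> 0" using cINF_lower[OF f_bdd_below, of x] by simp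
  have E: "c\<^sub>\<phi> * (f x - (INF y. f y)) + c\<^sub>z * (norm z)\<^sup>2 + 1 / 2 * (norm e)\<^sup>2 \<le> E"
    using assms V1_lower[of x z] by (simp add: V_def)
  have nonneg: "c\<^sub>\<phi> * (f x - (INF y. f y)) \<ge> 0" "c\<^sub>z * (norm z)\<^sup>2 \<ge> 0" "1 / 2 * (norm e)\<^sup>2 \<ge> 0"
    using f pos by simp_all
  have "c\<^sub>z * (norm z)\<^sup>2 \<le> E" using E nonneg by linarith
  then have "(norm z)\<^sup>2 \<le> E / c\<^sub>z" using pos(2) by (simp add: field_simps)
  then show "norm z \<le> sqrt (E / c\<^sub>z)" by (rule real_le_rsqrt)
  have "(norm e)\<^sup>2 \<le> 2 * E" using E nonneg by linarith
  then show "norm e \<le> sqrt (2 * E)" by (rule real_le_rsqrt)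
  have "c\<^sub>\<phi> * (f x - (INF y. f y)) \<le> E" using E nonneg by linarith
  then have "f x - (INF y. f y) \<le> E / c\<^sub>\<phi>" using pos(1) by (simp add: field_simps)
  moreover have L: "L + 1 > 0" using lipschitz_on_nonneg[OF grad_lipschitz] by simp
  \<comment> \<open>\<open>L\<close> may be \<open>0\<close>, while the gradient bound needs a positive constant.\<close>
  moreover have "(L + 1)-lipschitz_on UNIV (grad f)"
    by (rule lipschitz_on_le[OF grad_lipschitz]) simp
  ultimately have "(norm (grad f x))\<^sup>2 \<le> 4 * (L + 1) * (f x - (INF y. f y))"
    by (intro gradient_bound_of_lipschitz_gradient f_has_derivative f_bdd_below)
  also have "\<dots> \<le> 4 * (L + 1) * (E / c\<^sub>\<phi>)"
    using \<open>f x - (INF y. f y) \<le> E / c\<^sub>\<phi>\<close> L by (intro mult_left_mono) auto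
  finally show "norm (grad f x) \<le> sqrt (4 * (L + 1) * (E / c\<^sub>\<phi>))" by (rule real_le_rsqrt)
qed

text \<open>Although sublevel sets of \<open>V\<close> may be unbounded in \<open>x\<close>, the speed of \<open>x\<close> is bounded on them;
  this is where the growth condition on \<open>\<alpha>\<close> enters.\<close>
lemma velocity_bounded_on_sublevel:
  obtains B where "B \<ge> 0" "\<And>x z e. V x z e \<le> E \<Longrightarrow> norm (\<alpha> x z + e) \<le> B"
proof -
  define R where "R = 1 + \<bar>sqrt (E / c\<^sub>z)\<bar> + \<bar>sqrt (4 * (L + 1) * (E / c\<^sub>\<phi>))\<bar>"
  have "R > 0" unfolding R_def by (intro add_pos_nonneg) auto
  then obtain A where A: "\<And>x z. norm (grad f x) \<le> R \<Longrightarrow> norm z \<le> R \<Longrightarrow> norm (\<alpha> x z) \<le> A"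
    using \<alpha>_bounded[of R] unfolding bounded_iff by blast
  show thesis
  proof (rule that[of "\<bar>A\<bar> + \<bar>sqrt (2 * E)\<bar>"])
    fix x z e assume "V x z e \<le> E"
    note b = sublevel_bounds[OF this]
    have "norm (grad f x) \<le> R" "norm z \<le> R" using b unfolding R_def by linarith+
    then have "norm (\<alpha> x z) \<le> A" by (rule A)
    then show "norm (\<alpha> x z + e) \<le> \<bar>A\<bar> + \<bar>sqrt (2 * E)\<bar>"
      using norm_triangle_ineq[of "\<alpha> x z" e] b(2) by linarith
  qed simp
qed

text \<open>Up to time \<open>T\<close> the component \<open>x\<close> travels at most \<open>B * T\<close>, and \<open>z\<close>, \<open>e\<close> stay in the bounds
  given by the initial value of \<open>V\<close>. So a solution never leaves a ball fixed in advance.\<close>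
theorem closed_loop_exists:
  assumes "T \<ge> 0"
  obtains x z e where "solution q \<alpha> T s0 (\<lambda>t. feedback (x t) (z t) (e t)) x z e"
proof -
  obtain x0 z0 e0 where s0: "s0 = (x0, z0, e0)" by (metis prod_cases3)
  define E where "E = V x0 z0 e0"
  obtain B where "B \<ge> 0" and B: "\<And>x z e. V x z e \<le> E \<Longrightarrow> norm (\<alpha> x z + e) \<le> B"
    using velocity_bounded_on_sublevel[of E] by blast
  define R where "R = norm x0 + B * T + sqrt (E / c\<^sub>z) + sqrt (2 * E) + 1"
  have bound: "norm (y t) < R" if t: "t \<in> {0..T}" and y0: "y 0 = s0"
    and y: "\<And>s. s \<in> {0..t} \<Longrightarrow> (y has_vector_derivative closed_loop (y s)) (at s within {0..t})"
    for t y
  proof -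
    define x where "x = (\<lambda>s. fst (y s))"
    define z where "z = (\<lambda>s. fst (snd (y s)))"
    define e where "e = (\<lambda>s. snd (snd (y s)))"
    have le: "V (x s) (z s) (e s) \<le> E" if s: "s \<in> {0..t}" for s
    proof -
      have "(y has_vector_derivative closed_loop (y r)) (at r within {0..s})" if "r \<in> {0..s}" for r
        using s that by (intro has_vector_derivative_within_subset[OF y]) auto
      then have "V (x s) (z s) (e s) \<le> V (x 0) (z 0) (e 0)"
        using V_nonincreasing_closed_loop[OF _ closed_loop_curve_solution[of s y]] s
        by (auto simp: x_def z_def e_def)
      then show ?thesis by (simp add: E_def x_def z_def e_def y0 s0)
    qed
    have dx: "(x has_vector_derivative \<alpha> (x s) (z s) + e s) (at s within {0..t})" if "s \<in> {0..t}" for s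
      using bounded_linear.has_vector_derivative[OF bounded_linear_fst y[OF that]]
      by (simp add: x_def z_def e_def closed_loop_def case_prod_unfold)
    have I: "((\<lambda>s. \<alpha> (x s) (z s) + e s) has_integral (x t - x 0)) {0..t}"
      using t by (intro fundamental_theorem_of_calculus dx) auto
    have "norm (x t - x 0) \<le> B * measure lborel {0..t}"
      using B le by (intro has_integral_bound_real[OF \<open>B \<ge> 0\<close> finite.emptyI I]) auto
    also have "\<dots> = B * t" using t by simp
    also have "\<dots> \<le> B * T" using t \<open>B \<ge> 0\<close> by (intro mult_left_mono) auto
    finally have "norm (x t) \<le> norm x0 + B * T"
      using norm_triangle_sub[of "x t" "x 0"] by (simp add: x_def y0 s0)
    moreover have "norm (z t) \<le> sqrt (E / c\<^sub>z)" "norm (e t) \<le> sqrt (2 * E)"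
      using sublevel_bounds(1,2)[OF le[of t]] t by auto
    moreover have "norm (y t) \<le> norm (x t) + (norm (z t) + norm (e t))"
    proof -
      have "y t = (x t, z t, e t)" by (simp add: x_def z_def e_def)
      then show ?thesis 
        using norm_Pair_le[of "x t" "(z t, e t)"] norm_Pair_le[of "z t" "e t"] by simp
    qed
    ultimately show ?thesis by (simp add: R_def)
  qed
  obtain K where K: "K-lipschitz_on (cball 0 R) closed_loop"
    using closed_loop_lipschitz by blast
  have "norm s0 < R"
  proof -
    have "norm s0 \<le> norm x0 + (norm z0 + norm e0)"
      unfolding s0 using norm_Pair_le[of x0 "(z0, e0)"] norm_Pair_le[of z0 e0] by linarith
    moreover have "norm z0 \<le> sqrt (E / c\<^sub>z)" "norm e0 \<le> sqrt (2 * E)"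
      using sublevel_bounds(1,2)[of x0 z0 e0 E] by (simp_all add: E_def)
    moreover have "B * T \<ge> 0" using \<open>B \<ge> 0\<close> \<open>T \<ge> 0\<close> by simp
    ultimately show ?thesis unfolding R_def by linarith
  qed
  then have "\<exists>y. y 0 = s0 \<and>
      (\<forall>t\<in>{0..T}. (y has_vector_derivative closed_loop (y t)) (at t within {0..T}))"
  proof (rule solution_exists_if_a_priori_bounded[OF K \<open>T \<ge> 0\<close>])
    fix t y
    assume "t \<in> {0..T}" "y 0 = s0"
      and "\<And>s. s \<in> {0..t} \<Longrightarrow> (y has_vector_derivative closed_loop (y s)) (at s within {0..t})"
    then show "norm (y t) < R" by (rule bound[of t y])
  qed blast
  then obtain y where y0: "y 0 = s0"
    and y: "\<And>t. t \<in> {0..T} \<Longrightarrow> (y has_vector_derivative closed_loop (y t)) (at t within {0..T})"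
    by blast
  show thesis
    using closed_loop_curve_solution[OF y] y0 by (intro that) simp
qed

end

section \<open>Cost of a control and optimality\<close>

lemma nn_integral_eq_has_integral:
  fixes l :: "'a::euclidean_space \<Rightarrow> real"
  assumes "\<And>t. t \<in> S \<Longrightarrow> l t \<ge> 0" "(l has_integral I) S"
  shows "(\<integral>\<^sup>+ t \<in> S. ennreal (l t) \<partial>lebesgue) = ennreal I"
  by (simp only: nn_integral_completion nn_integral_has_integral_lebesgue'[OF assms])

lemma has_integral_of_finite_nn_integral:
  fixes l :: "real \<Rightarrow> real"
  assumes S: "S \<in> sets lebesgue" and nonneg: "\<And>t. t \<in> S \<Longrightarrow> l t \<ge> 0"
    and meas: "l \<in> borel_measurable (lebesgue_on S)"
    and fin: "(\<integral>\<^sup>+ t \<in> S. ennreal (l t) \<partial>lebesgue) \<noteq> \<infinity>"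
  obtains I where "(l has_integral I) S"
proof -
  have "(\<integral>\<^sup>+ t. ennreal (norm (l t)) \<partial>lebesgue_on S) = (\<integral>\<^sup>+ t \<in> S. ennreal (l t) \<partial>lebesgue)"
    using S nonneg by (subst nn_integral_restrict_space)
      (auto intro!: nn_integral_cong simp: indicator_def)
  then have "integrable (lebesgue_on S) l"
    using meas fin by (intro integrableI_bounded) (auto simp: top.not_eq_extremum)
  then have "set_integrable lebesgue S l"
    using S by (simp add: set_integrable_def integrable_restrict_space)
  then show thesis by (intro that) (rule has_integral_set_lebesgue)
qed

context backstepping begin

lemma running_cost_nonneg: "running_cost f q \<alpha> \<sigma> lam c x z e u \<ge> 0"
  unfolding running_cost_def using pos by (intro add_nonneg_nonneg mult_nonneg_nonneg) auto

definition trajectory_cost :: "real \<Rightarrow> (real \<Rightarrow> 'a) \<Rightarrow> (real \<Rightarrow> 'z) \<Rightarrow> (real \<Rightarrow> 'a) \<Rightarrow> (real \<Rightarrow> 'a) \<Rightarrow> ereal"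
  where
  "trajectory_cost T x z e u = ereal (V (x T) (z T) (e T)) +
     enn2ereal (\<integral>\<^sup>+ t \<in> {0..T}. ennreal (running_cost f q \<alpha> \<sigma> lam c (x t) (z t) (e t) (u t)) \<partial>lebesgue)"

text \<open>The trajectory chosen in the definition of the cost is a genuine solution; by itself this
  does not say which one.\<close>
lemma cost_functional_eq_trajectory_cost:
  assumes "solution q \<alpha> T s0 u x z e"
  obtains x' z' e' where "solution q \<alpha> T s0 u x' z' e'"
    "cost_functional f q \<alpha> V\<^sub>1 \<sigma> lam c T s0 u = trajectory_cost T x' z' e' u"
proof -
  obtain x' z' e' where some: "(SOME (x, z, e). solution q \<alpha> T s0 u x z e) = (x', z', e')"
    by (metis prod_cases3)
  have "(\<lambda>(x, z, e). solution q \<alpha> T s0 u x z e) (SOME (x, z, e). solution q \<alpha> T s0 u x z e)"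
    by (rule someI[of _ "(x, z, e)"]) (simp add: assms)
  then have "solution q \<alpha> T s0 u x' z' e'" unfolding some by simp
  then show thesis
    by (rule that) (simp add: cost_functional_def some trajectory_cost_def V_def)
qed

text \<open>Under the feedback law the square vanishes, so the running cost is exactly the rate at which
  \<open>V\<close> decreases.\<close>
lemma trajectory_cost_feedback:
  assumes "T \<ge> 0" and sol: "solution q \<alpha> T s0 u x z e"
    and u: "\<And>t. t \<in> {0..T} \<Longrightarrow> u t = feedback (x t) (z t) (e t)"
  shows "trajectory_cost T x z e u = ereal (V (x 0) (z 0) (e 0))"
proof -
  let ?l = "\<lambda>t. running_cost f q \<alpha> \<sigma> lam c (x t) (z t) (e t) (u t)"
  have "?l t = - V_dot (x t) (z t) (e t) (u t)" if "t \<in> {0..T}" for t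
    using completion_of_squares[of "x t" "z t" "e t" "u t"] u[OF that] by simp
  then have l: "(?l has_integral (V (x 0) (z 0) (e 0) - V (x T) (z T) (e T))) {0..T}"
    using has_integral_neg[OF energy_balance[OF assms(1,2)]]
    by (subst has_integral_cong) auto
  then have "V (x 0) (z 0) (e 0) - V (x T) (z T) (e T) \<ge> 0"
    by (rule has_integral_nonneg) (rule running_cost_nonneg)
  then show ?thesis
    using nn_integral_eq_has_integral[OF running_cost_nonneg l]
    by (simp add: trajectory_cost_def enn2ereal_ennreal)
qed

text \<open>If the integral of the running cost is infinite there is nothing to prove. Otherwise the
  running cost is integrable, and adding the energy balance to it shows that the square is integrable
  with integral equal to the excess of the cost over the initial value of \<open>V\<close>.\<close>
lemma trajectory_cost_lower_bound:
  assumes "T \<ge> 0" and sol: "solution q \<alpha> T s0 u x z e"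
    and u: "u absolutely_integrable_on {0..T}"
  shows "trajectory_cost T x z e u \<ge> ereal (V (x 0) (z 0) (e 0))"
    and "trajectory_cost T x z e u = ereal (V (x 0) (z 0) (e 0)) \<Longrightarrow>
      AE t in lebesgue_on {0..T}. u t = feedback (x t) (z t) (e t)"
proof -
  let ?l = "\<lambda>t. running_cost f q \<alpha> \<sigma> lam c (x t) (z t) (e t) (u t)"
  let ?r = "\<lambda>t. 1 / (2 * c) * (norm (u t - feedback (x t) (z t) (e t)))\<^sup>2"
  let ?I = "\<integral>\<^sup>+ t \<in> {0..T}. ennreal (?l t) \<partial>lebesgue"
  let ?V0 = "V (x 0) (z 0) (e 0)" and ?VT = "V (x T) (z T) (e T)"
  note cont = solution_continuous_on[OF sol]
  have "continuous_on {0..T} (\<lambda>t. grad f (x t))"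
    using continuous_on_compose[OF cont(1) continuous_on_grad] by (simp only: o_def)
  then have m[measurable]: "(\<lambda>t. grad f (x t)) \<in> borel_measurable (lebesgue_on {0..T})"
      "e \<in> borel_measurable (lebesgue_on {0..T})"
      "(\<lambda>t. alpha_dot q \<alpha> (x t) (z t) (e t)) \<in> borel_measurable (lebesgue_on {0..T})"
      "(\<lambda>t. feedback (x t) (z t) (e t)) \<in> borel_measurable (lebesgue_on {0..T})"
    using cont continuous_on_alpha_dot[OF cont] continuous_on_feedback[OF cont]
    by (auto intro!: continuous_imp_measurable_on_sets_lebesgue)
  have um[measurable]: "u \<in> borel_measurable (lebesgue_on {0..T})"
    using u by (simp add: absolutely_integrable_measurable)
  have meas: "?l \<in> borel_measurable (lebesgue_on {0..T})"
    unfolding running_cost_def by measurable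
  have finite_case: "(?r has_integral (I + (?VT - ?V0))) {0..T} \<and> I \<ge> 0 \<and>
      trajectory_cost T x z e u = ereal (?VT + I)" if "(?l has_integral I) {0..T}" for I
  proof (intro conjI)
    show "(?r has_integral (I + (?VT - ?V0))) {0..T}"
      unfolding completion_of_squares[symmetric]
      by (rule has_integral_add[OF that energy_balance[OF \<open>T \<ge> 0\<close> sol]])
    show "I \<ge> 0" using that by (rule has_integral_nonneg) (rule running_cost_nonneg)
    then show "trajectory_cost T x z e u = ereal (?VT + I)"
      using nn_integral_eq_has_integral[OF running_cost_nonneg that]
      by (simp add: trajectory_cost_def enn2ereal_ennreal)
  qed
  have r_nonneg: "?r t \<ge> 0" for t using pos(4) by simp
  have infinite_case: "trajectory_cost T x z e u = \<infinity>" if "?I = \<infinity>"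
    using that by (simp add: trajectory_cost_def)
  have finite_integral: "\<exists>I. (?l has_integral I) {0..T}" if "?I \<noteq> \<infinity>"
    by (rule has_integral_of_finite_nn_integral[OF _ running_cost_nonneg meas that]) (simp, rule exI)
  show "trajectory_cost T x z e u \<ge> ereal ?V0"
  proof (cases "?I = \<infinity>")
    case True
    then show ?thesis using infinite_case by simp
  next
    case False
    then obtain I where "(?l has_integral I) {0..T}" by (elim exE[OF finite_integral])
    note fin = finite_case[OF this]
    have "I + (?VT - ?V0) \<ge> 0"
      by (rule has_integral_nonneg[OF conjunct1[OF fin]]) (rule r_nonneg)
    then show ?thesis using fin by simp
  qed
  assume opt: "trajectory_cost T x z e u = ereal ?V0"
  then have "?I \<noteq> \<infinity>" using infinite_case by auto
  then obtain I where "(?l has_integral I) {0..T}" by (elim exE[OF finite_integral])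
  note fin = finite_case[OF this]
  have "?VT + I = ?V0" using fin opt by simp
  then have "I + (?VT - ?V0) = 0" by simp
  then have "(?r has_integral 0) {0..T}" using conjunct1[OF fin] by (simp only:)
  from nn_integral_eq_has_integral[OF r_nonneg this]
  have "(\<integral>\<^sup>+ t. ennreal (?r t) \<partial>lebesgue_on {0..T}) = 0"
    by (subst nn_integral_restrict_space) auto
  moreover have "(\<lambda>t. ennreal (?r t)) \<in> borel_measurable (lebesgue_on {0..T})"
    by measurable
  ultimately have "AE t in lebesgue_on {0..T}. ennreal (?r t) = 0"
    by (subst (asm) nn_integral_0_iff_AE)
  then show "AE t in lebesgue_on {0..T}. u t = feedback (x t) (z t) (e t)"
  proof eventually_elim
    case (elim t)
    then have "?r t \<le> 0" by (simp only: ennreal_eq_0_iff)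
    then show ?case using pos(4) by (simp add: mult_le_0_iff divide_le_0_iff)
  qed
qed

lemma feedback_control_iff:
  "feedback_control f q \<alpha> lam c T s0 u \<longleftrightarrow> (\<exists>x z e. solution q \<alpha> T s0 u x z e \<and>
     (\<forall>t\<in>{0..T}. u t = feedback (x t) (z t) (e t)))"
  by (simp only: feedback_control_def feedback_def)

lemma feedback_control_admissible:
  assumes "feedback_control f q \<alpha> lam c T s0 u"
  shows "admissible q \<alpha> T s0 u"
proof -
  obtain x z e where sol: "solution q \<alpha> T s0 u x z e"
    and u: "\<And>t. t \<in> {0..T} \<Longrightarrow> u t = feedback (x t) (z t) (e t)"
    using assms unfolding feedback_control_iff by blast
  have "continuous_on {0..T} u"
    by (rule continuous_on_eq[OF continuous_on_feedback[OF solution_continuous_on[OF sol]]]) (simp add: u)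
  then show ?thesis
    unfolding admissible_def using sol absolutely_integrable_continuous_real by blast
qed

text \<open>Uniqueness of open-loop trajectories is needed here: it ensures that the trajectory entering
  the cost is the one along which the feedback law was evaluated.\<close>
lemma cost_functional_feedback:
  assumes "T \<ge> 0" "feedback_control f q \<alpha> lam c T (x0, z0, e0) u"
  shows "cost_functional f q \<alpha> V\<^sub>1 \<sigma> lam c T (x0, z0, e0) u = ereal (V x0 z0 e0)"
proof -
  obtain x z e where sol: "solution q \<alpha> T (x0, z0, e0) u x z e"
    and u: "\<And>t. t \<in> {0..T} \<Longrightarrow> u t = feedback (x t) (z t) (e t)"
    using assms(2) unfolding feedback_control_iff by blast
  obtain x' z' e' where sol': "solution q \<alpha> T (x0, z0, e0) u x' z' e'"
    and J: "cost_functional f q \<alpha> V\<^sub>1 \<sigma> lam c T (x0, z0, e0) u = trajectory_cost T x' z' e' u"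
    by (rule cost_functional_eq_trajectory_cost[OF sol])
  have "u t = feedback (x' t) (z' t) (e' t)" if "t \<in> {0..T}" for t
    using u[OF that] open_loop_unique[OF sol sol' that] by simp
  then show ?thesis
    using trajectory_cost_feedback[OF assms(1) sol'] solutionD(4)[OF sol'] unfolding J by simp
qed

theorem feedback_unique_minimizer:
  assumes "T \<ge> 0"
  shows "(\<exists>us. feedback_control f q \<alpha> lam c T s0 us) \<and>
    (\<forall>us. feedback_control f q \<alpha> lam c T s0 us \<longrightarrow>
       is_arg_min (cost_functional f q \<alpha> V\<^sub>1 \<sigma> lam c T s0) (admissible q \<alpha> T s0) us \<and>
       (\<forall>v. is_arg_min (cost_functional f q \<alpha> V\<^sub>1 \<sigma> lam c T s0) (admissible q \<alpha> T s0) v \<longrightarrow>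
          (AE t in lebesgue_on {0..T}. v t = us t)))"
proof (intro conjI allI impI)
  let ?J = "cost_functional f q \<alpha> V\<^sub>1 \<sigma> lam c T s0"
  obtain x0 z0 e0 where s0: "s0 = (x0, z0, e0)" by (metis prod_cases3)
  show "\<exists>us. feedback_control f q \<alpha> lam c T s0 us"
  proof -
    obtain x z e where "solution q \<alpha> T s0 (\<lambda>t. feedback (x t) (z t) (e t)) x z e"
      by (rule closed_loop_exists[OF assms])
    then show ?thesis unfolding feedback_control_iff by blast
  qed
  fix us assume us: "feedback_control f q \<alpha> lam c T s0 us"
  have J_us: "?J us = ereal (V x0 z0 e0)"
    using cost_functional_feedback[OF assms] us unfolding s0 by blast
  have J_v: "?J v \<ge> ereal (V x0 z0 e0) \<and> (?J v = ereal (V x0 z0 e0) \<longrightarrow>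
      (\<exists>x z e. solution q \<alpha> T s0 v x z e \<and>
        (AE t in lebesgue_on {0..T}. v t = feedback (x t) (z t) (e t))))"
    if v: "admissible q \<alpha> T s0 v" for v
  proof -
    obtain x' z' e' where "solution q \<alpha> T s0 v x' z' e'"
      using v unfolding admissible_def by blast
    then obtain x z e where sol: "solution q \<alpha> T s0 v x z e" and J: "?J v = trajectory_cost T x z e v"
      by (rule cost_functional_eq_trajectory_cost)
    have "v absolutely_integrable_on {0..T}" using v by (simp add: admissible_def)
    note b = trajectory_cost_lower_bound[OF assms sol this]
    have init: "x 0 = x0" "z 0 = z0" "e 0 = e0" using solutionD(4)[OF sol] s0 by auto
    have "\<exists>x z e. solution q \<alpha> T s0 v x z e \<and>
        (AE t in lebesgue_on {0..T}. v t = feedback (x t) (z t) (e t))"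
      if "?J v = ereal (V x0 z0 e0)"
      using b(2) that unfolding J init by (intro exI conjI) (rule sol)
    then show ?thesis using b(1) unfolding J init by blast
  qed
  show "is_arg_min ?J (admissible q \<alpha> T s0) us"
    unfolding is_arg_min_def J_us
    using feedback_control_admissible[OF us] J_v by (meson leD)
  fix v assume "is_arg_min ?J (admissible q \<alpha> T s0) v"
  then have v: "admissible q \<alpha> T s0 v" "\<not> ?J us < ?J v"
    using feedback_control_admissible[OF us] by (auto simp: is_arg_min_def)
  then have "?J v = ereal (V x0 z0 e0)"
    using J_v[OF v(1)] unfolding J_us by (metis not_le order_antisym)
  then obtain x z e where sol: "solution q \<alpha> T s0 v x z e"
    and fb: "AE t in lebesgue_on {0..T}. v t = feedback (x t) (z t) (e t)"
    using J_v[OF v(1)] by blast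
  obtain x' z' e' where sol': "solution q \<alpha> T s0 us x' z' e'"
    and fb': "\<And>t. t \<in> {0..T} \<Longrightarrow> us t = feedback (x' t) (z' t) (e' t)"
    using us unfolding feedback_control_iff by blast
  have "AE t in lebesgue_on {0..T}. us t = feedback (x' t) (z' t) (e' t)"
    using fb' by (intro AE_I2) simp
  note same = closed_loop_unique[OF sol fb sol' this]
  show "AE t in lebesgue_on {0..T}. v t = us t"
    using fb AE_space
  proof eventually_elim
    case (elim t)
    then have "t \<in> {0..T}" by simp
    then show ?case using elim(1) fb' same by simp
  qed
qed

end

theorem proposition1:
  fixes f :: "real ^ 'n \<Rightarrow> real"
    and q :: "real ^ 'n \<Rightarrow> 'z::{real_inner, heine_borel, banach} \<Rightarrow> 'z"
    and \<alpha> :: "real ^ 'n \<Rightarrow> 'z \<Rightarrow> real ^ 'n"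
    and V\<^sub>1 :: "real ^ 'n \<Rightarrow> 'z \<Rightarrow> real"
    and L c\<^sub>\<phi> c\<^sub>z \<sigma> lam c T :: real
    and s0 :: "(real ^ 'n) \<times> 'z \<times> (real ^ 'n)"
  assumes "C2 f" and "convex_on UNIV f" and "L-lipschitz_on UNIV (grad f)"
    and "bdd_below (range f)"
    and "locally_lipschitz (\<lambda>(x, z). q x z)"
    and "C1 (\<lambda>(x, z). V\<^sub>1 x z)"
    and "\<And>x z. V\<^sub>1 x z \<ge> c\<^sub>\<phi> * (f x - (INF y. f y)) + c\<^sub>z * (norm z)\<^sup>2"
    and "\<And>x z e. grad (\<lambda>x'. V\<^sub>1 x' z) x \<bullet> (\<alpha> x z + e) + grad (\<lambda>z'. V\<^sub>1 x z') z \<bullet> q x z =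
           - \<sigma> * (norm (grad f x))\<^sup>2 + lam * (grad f x \<bullet> e)"
    and "C1 (\<lambda>(x, z). \<alpha> x z)"
    and "\<And>R. R > 0 \<Longrightarrow> bounded {\<alpha> x z | x z. norm (grad f x) \<le> R \<and> norm z \<le> R}"
    and "c\<^sub>\<phi> > 0" and "c\<^sub>z > 0" and "\<sigma> > 0" and "lam > 0" and "c > 0"
    and "T > 0"
  shows "(\<exists>us. feedback_control f q \<alpha> lam c T s0 us) \<and>
    (\<forall>us. feedback_control f q \<alpha> lam c T s0 us \<longrightarrow>
       is_arg_min (cost_functional f q \<alpha> V\<^sub>1 \<sigma> lam c T s0) (admissible q \<alpha> T s0) us \<and>
       (\<forall>v. is_arg_min (cost_functional f q \<alpha> V\<^sub>1 \<sigma> lam c T s0) (admissible q \<alpha> T s0) v \<longrightarrow>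
          (AE t in lebesgue_on {0..T}. v t = us t)))"
proof -
  interpret backstepping f q \<alpha> V\<^sub>1 L c\<^sub>\<phi> c\<^sub>z \<sigma> lam c
    by unfold_locales (fact assms)+
  show ?thesis
    by (rule feedback_unique_minimizer) (use \<open>T > 0\<close> in simp)
qed

end
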